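(* Let $S$ and $T$ be étale Boolean right restriction monoids. (1) Every homomorphism of Boolean inverse monoids $\theta\colon \mathsf{Inv}(S)\to\mathsf{Inv}(T)$ induces a homomorphism of Boolean right restriction monoids $\phi\colon S\to T$ which is the unique extension of $\theta$ (to a homomorphism of Boolean right restriction monoids). (2) If $\mathsf{Inv}(S)\cong\mathsf{Inv}(T)$ then $S\cong T$ as right restriction semigroups.
   Context: A right restriction semigroup is a semigroup $S$ with a unary operation $a\mapsto a^*$ satisfying: (RR1) $(s^* )^*=s^*$; (RR2) $(s^*t^* )^*=s^*t^*$; (RR3) $s^*t^*=t^*s^*$; (RR4) $ss^*=s$; (RR5) $(st)^*=(s^*t)^*$; (RR6) $t^*s=s(ts)^*$. Elements with $a^*=a$ are called projections; $\mathsf{Proj}(S)$ is the set of projections (they are commuting idempotents). The natural partial order is $a\le b$ iff $a=ba^*$; joins and meets refer to it. Elements $a,b$ are left-compatible, $a\sim_l b$, if $ab^*=ba^*$; a set is left-compatible if its elements are pairwise so. A homomorphism of right restriction semigroups is a semigroup homomorphism with $\theta(a^* )=\theta(a)^*$ (and preserving the identity for monoids). A Boolean right restriction monoid is a right restriction monoid in which every pair of left-compatible elements has a join, multiplication distributes from the right over such joins ($(a\vee b)c=ac\vee bc$), and $\mathsf{Proj}(S)$ is a Boolean algebra under the natural partial order, whose bottom $0$ is the zero of the monoid (the empty join). A homomorphism of Boolean right restriction monoids is a homomorphism of right restriction monoids preserving all finite left-compatible joins (including $0$). An element $a\in S$ is a partial unit if there is $b\in S$ with $ba=a^*$ and $ab=b^*$;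 $\mathsf{Inv}(S)$ is the set of partial units. It is an inverse monoid under multiplication with set of idempotents $\mathsf{Proj}(S)$, and when $S$ is Boolean it is a Boolean inverse monoid. $S$ is étale if every element is a join of a finite number of partial units. In an inverse monoid, $a^*=a^{-1}a$; $a,b$ are compatible if $ab^{-1}$ and $a^{-1}b$ are both idempotents. A Boolean inverse monoid is an inverse monoid with zero in which every pair of compatible elements has a join, multiplication distributes over such joins, and the idempotents form a Boolean algebra. Homomorphisms of Boolean inverse monoids are monoid homomorphisms preserving all finite compatible joins (including $0$). Isomorphism of Boolean inverse monoids is bijective homomorphism. *)

theory Defs
  imports "HOL-Algebra.Group" "HOL-Algebra.Lattice"
begin

section \<open>Right restriction semigroups and monoids\<close>

record 'a right_restriction = "'a monoid" +
  rstar :: "'a \<Rightarrow> 'a"  (\<open>_\<^sup>\<star>\<index>\<close> [1000] 999)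

text \<open>The field \<open>one\<close> of the record is unconstrained in the semigroup locale.\<close>

locale right_restriction_semigroup =
  fixes S (structure)
  assumes mult_closed: "\<lbrakk>s \<in> carrier S; t \<in> carrier S\<rbrakk> \<Longrightarrow> s \<otimes> t \<in> carrier S"
    and mult_assoc: "\<lbrakk>s \<in> carrier S; t \<in> carrier S; u \<in> carrier S\<rbrakk>
      \<Longrightarrow> (s \<otimes> t) \<otimes> u = s \<otimes> (t \<otimes> u)"
    and rstar_closed: "s \<in> carrier S \<Longrightarrow> s\<^sup>\<star> \<in> carrier S"
    and RR1: "s \<in> carrier S \<Longrightarrow> (s\<^sup>\<star>)\<^sup>\<star> = s\<^sup>\<star>"
    and RR2: "\<lbrakk>s \<in> carrier S; t \<in> carrier S\<rbrakk> \<Longrightarrow> (s\<^sup>\<star> \<otimes> t\<^sup>\<star>)\<^sup>\<star> = s\<^sup>\<star> \<otimes> t\<^sup>\<star>"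
    and RR3: "\<lbrakk>s \<in> carrier S; t \<in> carrier S\<rbrakk> \<Longrightarrow> s\<^sup>\<star> \<otimes> t\<^sup>\<star> = t\<^sup>\<star> \<otimes> s\<^sup>\<star>"
    and RR4: "s \<in> carrier S \<Longrightarrow> s \<otimes> s\<^sup>\<star> = s"
    and RR5: "\<lbrakk>s \<in> carrier S; t \<in> carrier S\<rbrakk> \<Longrightarrow> (s \<otimes> t)\<^sup>\<star> = (s\<^sup>\<star> \<otimes> t)\<^sup>\<star>"
    and RR6: "\<lbrakk>s \<in> carrier S; t \<in> carrier S\<rbrakk> \<Longrightarrow> t\<^sup>\<star> \<otimes> s = s \<otimes> (t \<otimes> s)\<^sup>\<star>"

locale right_restriction_monoid = right_restriction_semigroup S + monoid S
  for S (structure)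

definition Proj :: "('a, 'b) right_restriction_scheme \<Rightarrow> 'a set"
  where "Proj S = {a \<in> carrier S. a\<^sup>\<star>\<^bsub>S\<^esub> = a}"

definition natural_order :: "('a, 'b) right_restriction_scheme \<Rightarrow> 'a gorder"
  where "natural_order S = \<lparr>carrier = carrier S, eq = (=), le = (\<lambda>a b. a = b \<otimes>\<^bsub>S\<^esub> a\<^sup>\<star>\<^bsub>S\<^esub>)\<rparr>"

definition left_compatible :: "('a, 'b) right_restriction_scheme \<Rightarrow> 'a \<Rightarrow> 'a \<Rightarrow> bool"
  where "left_compatible S a b \<longleftrightarrow> a \<otimes>\<^bsub>S\<^esub> b\<^sup>\<star>\<^bsub>S\<^esub> = b \<otimes>\<^bsub>S\<^esub> a\<^sup>\<star>\<^bsub>S\<^esub>"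

definition rr_hom ::
  "('a, 'c) right_restriction_scheme \<Rightarrow> ('b, 'd) right_restriction_scheme \<Rightarrow> ('a \<Rightarrow> 'b) set"
  where "rr_hom S T = {h \<in> hom S T. \<forall>a \<in> carrier S. h (a\<^sup>\<star>\<^bsub>S\<^esub>) = (h a)\<^sup>\<star>\<^bsub>T\<^esub>}"

definition rr_iso ::
  "('a, 'c) right_restriction_scheme \<Rightarrow> ('b, 'd) right_restriction_scheme \<Rightarrow> ('a \<Rightarrow> 'b) set"
  where "rr_iso S T = {h \<in> rr_hom S T. bij_betw h (carrier S) (carrier T)}"

definition rr_monoid_hom ::
  "('a, 'c) right_restriction_scheme \<Rightarrow> ('b, 'd) right_restriction_scheme \<Rightarrow> ('a \<Rightarrow> 'b) set"
  where "rr_monoid_hom S T = {h \<in> rr_hom S T. h \<one>\<^bsub>S\<^esub> = \<one>\<^bsub>T\<^esub>}"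


section \<open>Boolean right restriction monoids\<close>

locale boolean_lattice = bounded_lattice +
  assumes meet_join_distrib: "\<lbrakk>x \<in> carrier L; y \<in> carrier L; z \<in> carrier L\<rbrakk>
      \<Longrightarrow> x \<sqinter> (y \<squnion> z) = (x \<sqinter> y) \<squnion> (x \<sqinter> z)"
    and ex_complement: "x \<in> carrier L \<Longrightarrow> \<exists>y \<in> carrier L. x \<sqinter> y = \<bottom> \<and> x \<squnion> y = \<top>"

definition Proj_order :: "('a, 'b) right_restriction_scheme \<Rightarrow> 'a gorder"
  where "Proj_order S = natural_order S\<lparr>carrier := Proj S\<rparr>"

locale boolean_right_restriction_monoid = right_restriction_monoid +
  assumes left_compatible_join:
      "\<lbrakk>a \<in> carrier S; b \<in> carrier S; left_compatible S a b\<rbrakk>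
        \<Longrightarrow> \<exists>j. is_lub (natural_order S) j {a, b}"
    and join_distrib_right:
      "\<lbrakk>a \<in> carrier S; b \<in> carrier S; c \<in> carrier S; left_compatible S a b;
        is_lub (natural_order S) j {a, b}\<rbrakk>
        \<Longrightarrow> is_lub (natural_order S) (j \<otimes> c) {a \<otimes> c, b \<otimes> c}"
    and boolean_Proj: "boolean_lattice (Proj_order S)"
    and bottom_zero: "a \<in> carrier S
        \<Longrightarrow> \<bottom>\<^bsub>Proj_order S\<^esub> \<otimes> a = \<bottom>\<^bsub>Proj_order S\<^esub> \<and> a \<otimes> \<bottom>\<^bsub>Proj_order S\<^esub> = \<bottom>\<^bsub>Proj_order S\<^esub>"

text \<open>Taking \<open>A = {}\<close> below gives preservation of \<open>0\<close>.\<close>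

definition boolean_rr_hom ::
  "('a, 'c) right_restriction_scheme \<Rightarrow> ('b, 'd) right_restriction_scheme \<Rightarrow> ('a \<Rightarrow> 'b) set"
  where "boolean_rr_hom S T = {h \<in> rr_monoid_hom S T.
    \<forall>A j. finite A \<and> A \<subseteq> carrier S \<and> (\<forall>a \<in> A. \<forall>b \<in> A. left_compatible S a b)
      \<and> is_lub (natural_order S) j A \<longrightarrow> is_lub (natural_order T) (h j) (h ` A)}"


section \<open>Boolean inverse monoids\<close>

definition is_inverse :: "('a, 'b) monoid_scheme \<Rightarrow> 'a \<Rightarrow> 'a \<Rightarrow> bool"
  where "is_inverse M a b \<longleftrightarrow> b \<in> carrier M
    \<and> a \<otimes>\<^bsub>M\<^esub> b \<otimes>\<^bsub>M\<^esub> a = a \<and> b \<otimes>\<^bsub>M\<^esub> a \<otimes>\<^bsub>M\<^esub> b = b"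

locale inverse_monoid = monoid M for M (structure) +
  assumes ex1_inverse: "a \<in> carrier M \<Longrightarrow> \<exists>!b. is_inverse M a b"

text \<open>This is the inverse of semigroup theory, not the group inverse \<^const>\<open>m_inv\<close>.\<close>

definition im_inv :: "('a, 'b) monoid_scheme \<Rightarrow> 'a \<Rightarrow> 'a"
  where "im_inv M a = (THE b. is_inverse M a b)"

definition Idempotents :: "('a, 'b) monoid_scheme \<Rightarrow> 'a set"
  where "Idempotents M = {e \<in> carrier M. e \<otimes>\<^bsub>M\<^esub> e = e}"

text \<open>An inverse monoid is a right restriction monoid with \<open>a\<^sup>\<star> = a\<inverse>a\<close>; its natural partial
  order is the one of this right restriction monoid.\<close>

definition inverse_rr :: "('a, 'b) monoid_scheme \<Rightarrow> 'a right_restriction"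
  where "inverse_rr M = \<lparr>carrier = carrier M, mult = mult M, one = \<one>\<^bsub>M\<^esub>,
    rstar = (\<lambda>a. im_inv M a \<otimes>\<^bsub>M\<^esub> a)\<rparr>"

abbreviation im_order :: "('a, 'b) monoid_scheme \<Rightarrow> 'a gorder"
  where "im_order M \<equiv> natural_order (inverse_rr M)"

definition compatible :: "('a, 'b) monoid_scheme \<Rightarrow> 'a \<Rightarrow> 'a \<Rightarrow> bool"
  where "compatible M a b \<longleftrightarrow>
    a \<otimes>\<^bsub>M\<^esub> im_inv M b \<in> Idempotents M \<and> im_inv M a \<otimes>\<^bsub>M\<^esub> b \<in> Idempotents M"

locale boolean_inverse_monoid = inverse_monoid +
  assumes ex_zero: "\<exists>z \<in> carrier M. \<forall>a \<in> carrier M. z \<otimes> a = z \<and> a \<otimes> z = z"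
    and compatible_join: "\<lbrakk>a \<in> carrier M; b \<in> carrier M; compatible M a b\<rbrakk>
        \<Longrightarrow> \<exists>j. is_lub (im_order M) j {a, b}"
    and compatible_join_distrib_right:
      "\<lbrakk>a \<in> carrier M; b \<in> carrier M; c \<in> carrier M; compatible M a b;
        is_lub (im_order M) j {a, b}\<rbrakk> \<Longrightarrow> is_lub (im_order M) (j \<otimes> c) {a \<otimes> c, b \<otimes> c}"
    and compatible_join_distrib_left:
      "\<lbrakk>a \<in> carrier M; b \<in> carrier M; c \<in> carrier M; compatible M a b;
        is_lub (im_order M) j {a, b}\<rbrakk> \<Longrightarrow> is_lub (im_order M) (c \<otimes> j) {c \<otimes> a, c \<otimes> b}"
    and boolean_Idem: "boolean_lattice (im_order M\<lparr>carrier := Idempotents M\<rparr>)"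

definition boolean_inverse_hom ::
  "('a, 'c) monoid_scheme \<Rightarrow> ('b, 'd) monoid_scheme \<Rightarrow> ('a \<Rightarrow> 'b) set"
  where "boolean_inverse_hom M N = {h \<in> hom M N. h \<one>\<^bsub>M\<^esub> = \<one>\<^bsub>N\<^esub> \<and>
    (\<forall>A j. finite A \<and> A \<subseteq> carrier M \<and> (\<forall>a \<in> A. \<forall>b \<in> A. compatible M a b)
      \<and> is_lub (im_order M) j A \<longrightarrow> is_lub (im_order N) (h j) (h ` A))}"

definition boolean_inverse_iso ::
  "('a, 'c) monoid_scheme \<Rightarrow> ('b, 'd) monoid_scheme \<Rightarrow> ('a \<Rightarrow> 'b) set"
  where "boolean_inverse_iso M N =
    {h \<in> boolean_inverse_hom M N. bij_betw h (carrier M) (carrier N)}"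


section \<open>Partial units and etale monoids\<close>

definition partial_unit :: "('a, 'b) right_restriction_scheme \<Rightarrow> 'a \<Rightarrow> bool"
  where "partial_unit S a \<longleftrightarrow> a \<in> carrier S \<and>
    (\<exists>b \<in> carrier S. b \<otimes>\<^bsub>S\<^esub> a = a\<^sup>\<star>\<^bsub>S\<^esub> \<and> a \<otimes>\<^bsub>S\<^esub> b = b\<^sup>\<star>\<^bsub>S\<^esub>)"

definition Inv :: "('a, 'b) right_restriction_scheme \<Rightarrow> 'a monoid"
  where "Inv S = \<lparr>carrier = {a. partial_unit S a}, mult = mult S, one = \<one>\<^bsub>S\<^esub>\<rparr>"

locale etale_boolean_right_restriction_monoid = boolean_right_restriction_monoid +
  assumes etale: "a \<in> carrier S
    \<Longrightarrow> \<exists>A. finite A \<and> A \<subseteq> carrier (Inv S) \<and> is_lub (natural_order S) a A"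


section \<open>The partial units form a Boolean inverse monoid\<close>

context right_restriction_monoid begin

lemmas rr_closed = mult_closed rstar_closed

lemma Proj_carrier: "e \<in> Proj S \<Longrightarrow> e \<in> carrier S" by (simp add: Proj_def)
lemma Proj_star: "e \<in> Proj S \<Longrightarrow> e\<^sup>\<star> = e" by (simp add: Proj_def)
lemma star_Proj: "a \<in> carrier S \<Longrightarrow> a\<^sup>\<star> \<in> Proj S" by (simp add: Proj_def rr_closed RR1)
lemma Proj_comm: "e \<in> Proj S \<Longrightarrow> f \<in> Proj S \<Longrightarrow> e \<otimes> f = f \<otimes> e"
  using RR3[of e f] by (simp add: Proj_def)
lemma Proj_idem: "e \<in> Proj S \<Longrightarrow> e \<otimes> e = e"
  using RR4[of e] by (simp add: Proj_def)
lemma Proj_mult: "e \<in> Proj S \<Longrightarrow> f \<in> Proj S \<Longrightarrow> e \<otimes> f \<in> Proj S"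
  using RR2[of e f] by (simp add: Proj_def mult_closed)
lemma star_mult_Proj: "a \<in> carrier S \<Longrightarrow> e \<in> Proj S \<Longrightarrow> (a \<otimes> e)\<^sup>\<star> = a\<^sup>\<star> \<otimes> e"
  using RR5[of a e] RR2[of a e] by (simp add: Proj_def)
lemma Proj_mult_left: "a \<in> carrier S \<Longrightarrow> e \<in> Proj S \<Longrightarrow> e \<otimes> a = a \<otimes> (e \<otimes> a)\<^sup>\<star>"
  using RR6[of a e] by (simp add: Proj_def)
lemma one_Proj: "\<one> \<in> Proj S"
  using RR4[of \<one>] by (simp add: Proj_def rr_closed)

definition "leS a b \<longleftrightarrow> a = b \<otimes> a\<^sup>\<star>"

lemma leS_I: "\<lbrakk>a = b \<otimes> e; b \<in> carrier S; e \<in> Proj S\<rbrakk> \<Longrightarrow> leS a b"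
  unfolding leS_def
  by (simp add: star_mult_Proj)
     (metis Proj_carrier Proj_comm Proj_idem RR4 mult_assoc rstar_closed star_Proj)

lemma leS_refl: "a \<in> carrier S \<Longrightarrow> leS a a" by (simp add: leS_def RR4)
lemma leS_antisym: "\<lbrakk>a \<in> carrier S; b \<in> carrier S; leS a b; leS b a\<rbrakk> \<Longrightarrow> a = b"
  unfolding leS_def by (metis RR3 RR4 RR5 RR1 mult_assoc rstar_closed)
lemma leS_trans:
  assumes "b \<in> carrier S" "c \<in> carrier S" "a \<in> carrier S" "leS a b" "leS b c"
  shows "leS a c"
proof (rule leS_I)
  have "a = b \<otimes> a\<^sup>\<star>" using assms(4) by (simp add: leS_def)
  also have "b = c \<otimes> b\<^sup>\<star>" using assms(5) by (simp add: leS_def)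
  also have "c \<otimes> b\<^sup>\<star> \<otimes> a\<^sup>\<star> = c \<otimes> (b\<^sup>\<star> \<otimes> a\<^sup>\<star>)" using assms by (intro mult_assoc rstar_closed)
  finally show "a = c \<otimes> (b\<^sup>\<star> \<otimes> a\<^sup>\<star>)" .
qed (use assms in \<open>simp_all add: Proj_mult star_Proj\<close>)
lemma leS_star: assumes "a \<in> carrier S" "b \<in> carrier S" "leS a b" shows "a\<^sup>\<star> = b\<^sup>\<star> \<otimes> a\<^sup>\<star>"
proof -
  have "(b \<otimes> a\<^sup>\<star>)\<^sup>\<star> = b\<^sup>\<star> \<otimes> a\<^sup>\<star>" using assms star_Proj by (intro star_mult_Proj)
  then show ?thesis using assms(3) unfolding leS_def by simp
qed
lemma leS_mult_right:
  assumes "a \<in> carrier S" "b \<in> carrier S" "c \<in> carrier S" "leS a b"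
  shows "leS (a \<otimes> c) (b \<otimes> c)"
proof (rule leS_I)
  have "a \<otimes> c = b \<otimes> a\<^sup>\<star> \<otimes> c" using assms(4) by (simp add: leS_def)
  also have "\<dots> = b \<otimes> (a\<^sup>\<star> \<otimes> c)" using assms by (intro mult_assoc rstar_closed)
  also have "a\<^sup>\<star> \<otimes> c = c \<otimes> (a \<otimes> c)\<^sup>\<star>" using assms by (intro RR6)
  also have "b \<otimes> (c \<otimes> (a \<otimes> c)\<^sup>\<star>) = b \<otimes> c \<otimes> (a \<otimes> c)\<^sup>\<star>"
    using assms by (intro mult_assoc[symmetric] rstar_closed mult_closed)
  finally show "a \<otimes> c = b \<otimes> c \<otimes> (a \<otimes> c)\<^sup>\<star>" .
qed (use assms in \<open>simp_all add: mult_closed star_Proj\<close>)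
lemma leS_mult_left:
  assumes "a \<in> carrier S" "b \<in> carrier S" "c \<in> carrier S" "leS a b"
  shows "leS (c \<otimes> a) (c \<otimes> b)"
proof (rule leS_I)
  have "c \<otimes> a = c \<otimes> (b \<otimes> a\<^sup>\<star>)" using assms(4) by (simp add: leS_def)
  also have "\<dots> = c \<otimes> b \<otimes> a\<^sup>\<star>" using assms by (intro mult_assoc[symmetric] rstar_closed)
  finally show "c \<otimes> a = c \<otimes> b \<otimes> a\<^sup>\<star>" .
qed (use assms in \<open>simp_all add: mult_closed star_Proj\<close>)
lemma leS_Proj: "\<lbrakk>a \<in> carrier S; e \<in> Proj S; leS a e\<rbrakk> \<Longrightarrow> a \<in> Proj S"
  using Proj_mult[of e "a\<^sup>\<star>"] star_Proj[of a] by (simp add: leS_def[of a])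

definition "lubS j a b \<longleftrightarrow> j \<in> carrier S \<and> leS a j \<and> leS b j \<and> (\<forall>u\<in>carrier S. leS a u \<and> leS b u \<longrightarrow> leS j u)"

lemma lubS: "a \<in> carrier S \<Longrightarrow> b \<in> carrier S \<Longrightarrow> is_lub (natural_order S) j {a,b} \<longleftrightarrow> lubS j a b"
  by (auto simp: least_def Upper_def natural_order_def lubS_def leS_def)

definition "pinv a b \<longleftrightarrow> a \<in> carrier S \<and> b \<in> carrier S \<and> b \<otimes> a = a\<^sup>\<star> \<and> a \<otimes> b = b\<^sup>\<star>"

lemma pinv_sym: "pinv a b \<Longrightarrow> pinv b a" by (simp add: pinv_def)
lemma Inv_pinv: "a \<in> carrier (Inv S) \<longleftrightarrow> (\<exists>b. pinv a b)"
  by (auto simp: Inv_def partial_unit_def pinv_def)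
lemma pinv_Inv: "pinv a b \<Longrightarrow> a \<in> carrier (Inv S)" "pinv a b \<Longrightarrow> b \<in> carrier (Inv S)"
  by (auto simp: Inv_pinv dest: pinv_sym)
lemma Inv_carrier: "a \<in> carrier (Inv S) \<Longrightarrow> a \<in> carrier S" by (auto simp: Inv_pinv pinv_def)
lemma pinv_Proj: "e \<in> Proj S \<Longrightarrow> pinv e e"
  by (simp add: pinv_def Proj_carrier Proj_star Proj_idem)

lemma pinv_mult: assumes "pinv a b" "pinv c d" shows "pinv (a \<otimes> c) (d \<otimes> b)"
proof -
  have *: "(d \<otimes> b) \<otimes> (a \<otimes> c) = (a \<otimes> c)\<^sup>\<star>" if "pinv a b" "pinv c d" for a b c d
  proof -
    have cl: "a \<in> carrier S" "b \<in> carrier S" "c \<in> carrier S" "d \<in> carrier S"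
      using that by (auto simp: pinv_def)
    have ac: "a \<otimes> c \<in> carrier S" "(a \<otimes> c)\<^sup>\<star> \<in> carrier S" "c\<^sup>\<star> \<in> carrier S"
      using cl by (simp_all add: mult_closed rstar_closed)
    have "(d \<otimes> b) \<otimes> (a \<otimes> c) = d \<otimes> ((b \<otimes> a) \<otimes> c)"
      using cl by (simp add: mult_assoc mult_closed)
    also have "b \<otimes> a = a\<^sup>\<star>" using that by (simp add: pinv_def)
    also have "a\<^sup>\<star> \<otimes> c = c \<otimes> (a \<otimes> c)\<^sup>\<star>" using cl by (intro RR6)
    also have "d \<otimes> (c \<otimes> (a \<otimes> c)\<^sup>\<star>) = d \<otimes> c \<otimes> (a \<otimes> c)\<^sup>\<star>"
      using cl ac by (intro mult_assoc[symmetric])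
    also have "d \<otimes> c = c\<^sup>\<star>" using that by (simp add: pinv_def)
    also have "c\<^sup>\<star> \<otimes> (a \<otimes> c)\<^sup>\<star> = (a \<otimes> c)\<^sup>\<star> \<otimes> c\<^sup>\<star>" using cl ac by (intro RR3)
    also have "\<dots> = (a \<otimes> c \<otimes> c\<^sup>\<star>)\<^sup>\<star>"
      using star_mult_Proj[OF ac(1) star_Proj[OF cl(3)]] by simp
    also have "a \<otimes> c \<otimes> c\<^sup>\<star> = a \<otimes> c" using cl ac by (simp add: mult_assoc RR4)
    finally show ?thesis .
  qed
  show ?thesis using *[OF assms] *[OF pinv_sym[OF assms(2)] pinv_sym[OF assms(1)]] assms
    by (auto simp: pinv_def mult_closed)
qed

lemma pinv_idem: assumes "pinv a b" "a \<otimes> a = a" shows "a \<in> Proj S"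
proof -
  have cl: "a \<in> carrier S" "b \<in> carrier S" using assms by (auto simp: pinv_def)
  have "a\<^sup>\<star> \<otimes> a = b \<otimes> (a \<otimes> a)"
    using assms(1) mult_assoc[OF cl(2) cl(1) cl(1)] by (simp add: pinv_def)
  then have "a\<^sup>\<star> \<otimes> a = a\<^sup>\<star>" using assms by (simp add: pinv_def)
  moreover have "a\<^sup>\<star> \<otimes> a = a" using RR6[of a a] cl assms by (simp add: RR4)
  ultimately show ?thesis by (simp add: Proj_def cl)
qed

lemma Inv_simps: "x \<otimes>\<^bsub>Inv S\<^esub> y = x \<otimes> y" "\<one>\<^bsub>Inv S\<^esub> = \<one>"
  by (simp_all add: Inv_def)

lemma Idem_Inv: "Idempotents (Inv S) = Proj S"
proof (intro equalityI subsetI)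
  fix e assume "e \<in> Idempotents (Inv S)"
  then have e: "e \<in> carrier (Inv S)" "e \<otimes> e = e" by (simp_all add: Idempotents_def Inv_simps)
  then obtain f where "pinv e f" using Inv_pinv by metis
  then show "e \<in> Proj S" using e(2) by (rule pinv_idem)
next
  fix e assume "e \<in> Proj S"
  then show "e \<in> Idempotents (Inv S)"
    using pinv_Inv(1)[OF pinv_Proj] by (simp add: Idempotents_def Inv_simps Proj_idem)
qed

lemma pinv_is_inverse:
  assumes "pinv a b" shows "is_inverse (Inv S) a b"
proof -
  have *: "a \<otimes> b \<otimes> a = a" if "pinv a b" for a b
  proof -
    have "a \<otimes> b \<otimes> a = a \<otimes> (b \<otimes> a)" by (rule mult_assoc) (use that in \<open>simp_all add: pinv_def\<close>)
    also have "\<dots> = a" using that by (simp add: pinv_def RR4)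
    finally show ?thesis .
  qed
  show ?thesis
    unfolding is_inverse_def using *[OF assms] *[OF pinv_sym[OF assms]] pinv_Inv(2)[OF assms]
    by (simp add: Inv_def)
qed

lemma is_inverse_unique:
  assumes "pinv a b" "is_inverse (Inv S) a c" shows "c = b"
proof -
  have b: "is_inverse (Inv S) a b" by (rule pinv_is_inverse) fact
  obtain d where d: "pinv c d" using assms(2) by (auto simp: is_inverse_def Inv_pinv)
  have cl: "a \<in> carrier S" "b \<in> carrier S" "c \<in> carrier S"
    using assms d by (auto simp: pinv_def)
  have eqs: "a \<otimes> (b \<otimes> a) = a" "b \<otimes> (a \<otimes> b) = b" "a \<otimes> (c \<otimes> a) = a" "c \<otimes> (a \<otimes> c) = c"
    using b assms(2) cl by (auto simp: is_inverse_def Inv_def mult_assoc)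
  have "a \<otimes> c \<otimes> (a \<otimes> c) = a \<otimes> c" "c \<otimes> a \<otimes> (c \<otimes> a) = c \<otimes> a"
    using eqs cl by (simp_all add: mult_assoc mult_closed)
  note P = pinv_idem[OF pinv_mult[OF assms(1) d] this(1)] pinv_idem[OF pinv_mult[OF d assms(1)] this(2)]
  have P2: "a \<otimes> b \<in> Proj S" "b \<otimes> a \<in> Proj S"
    using assms(1) star_Proj by (simp_all add: pinv_def)
  have "c = (c \<otimes> a) \<otimes> (b \<otimes> a) \<otimes> c" using eqs cl by (simp add: mult_assoc mult_closed)
  also have "(c \<otimes> a) \<otimes> (b \<otimes> a) = (b \<otimes> a) \<otimes> (c \<otimes> a)" by (intro Proj_comm P P2)
  also have "\<dots> \<otimes> c = b \<otimes> (a \<otimes> c)" using eqs cl by (simp add: mult_assoc mult_closed)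
  also have "\<dots> = b \<otimes> (a \<otimes> b) \<otimes> (a \<otimes> c)" using eqs(2) by simp
  also have "\<dots> = b \<otimes> ((a \<otimes> b) \<otimes> (a \<otimes> c))" using cl by (simp add: mult_assoc mult_closed)
  also have "(a \<otimes> b) \<otimes> (a \<otimes> c) = (a \<otimes> c) \<otimes> (a \<otimes> b)" by (intro Proj_comm P P2)
  also have "\<dots> = a \<otimes> (c \<otimes> a) \<otimes> b" using cl by (simp add: mult_assoc mult_closed)
  also have "\<dots> = a \<otimes> b" using eqs(3) by simp
  also have "b \<otimes> \<dots> = b" by (rule eqs(2))
  finally show ?thesis .
qed

lemma im_inv_Inv: "pinv a b \<Longrightarrow> im_inv (Inv S) a = b"
  unfolding im_inv_def using is_inverse_unique pinv_is_inverse by blast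

lemma inverse_monoid_Inv: "inverse_monoid (Inv S)"
proof -
  have "monoid (Inv S)"
  proof (rule monoidI, unfold Inv_simps)
    show "x \<otimes> y \<in> carrier (Inv S)" if "x \<in> carrier (Inv S)" "y \<in> carrier (Inv S)" for x y
    proof -
      obtain x' y' where "pinv x x'" "pinv y y'" using \<open>x \<in> _\<close> \<open>y \<in> _\<close> Inv_pinv by metis
      then show ?thesis by (rule pinv_Inv(1)[OF pinv_mult])
    qed
    show "\<one> \<in> carrier (Inv S)" by (rule pinv_Inv(1)[OF pinv_Proj[OF one_Proj]])
  qed (simp_all add: Inv_carrier mult_assoc)
  moreover have "inverse_monoid_axioms (Inv S)"
  proof
    fix a assume "a \<in> carrier (Inv S)"
    then obtain b where "pinv a b" using Inv_pinv by metis
    then show "\<exists>!b. is_inverse (Inv S) a b"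
      using pinv_is_inverse[of a b] is_inverse_unique[of a b] by (intro ex1I[of _ b])
  qed
  ultimately show ?thesis by (simp add: inverse_monoid_def)
qed

lemma im_star: assumes "a \<in> carrier (Inv S)" shows "a\<^sup>\<star>\<^bsub>inverse_rr (Inv S)\<^esub> = a\<^sup>\<star>"
proof -
  obtain b where "pinv a b" using assms Inv_pinv by metis
  then show ?thesis using im_inv_Inv[of a b] by (simp add: inverse_rr_def Inv_simps pinv_def)
qed

lemma im_le: "a \<in> carrier (Inv S) \<Longrightarrow> a \<sqsubseteq>\<^bsub>im_order (Inv S)\<^esub> b \<longleftrightarrow> leS a b"
  using im_star[of a] by (simp add: natural_order_def leS_def) (simp add: inverse_rr_def Inv_simps)
lemma im_carrier: "carrier (im_order (Inv S)) = carrier (Inv S)"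
  by (auto simp: natural_order_def inverse_rr_def)

lemma compatible_left:
  assumes "pinv a a'" "pinv b b'" "a \<otimes> b' \<in> Proj S"
  shows "left_compatible S a b"
proof -
  have cl: "a \<in> carrier S" "a' \<in> carrier S" "b \<in> carrier S" "b' \<in> carrier S"
    using assms by (auto simp: pinv_def)
  have 1: "a \<otimes> b\<^sup>\<star> = (a \<otimes> b') \<otimes> b" using assms cl by (simp add: pinv_def mult_assoc)
  then have "leS (a \<otimes> b\<^sup>\<star>) b" using Proj_mult_left[OF cl(3) assms(3)] cl
    by (metis leS_I mult_closed star_Proj)
  then have "a \<otimes> b\<^sup>\<star> = b \<otimes> (a\<^sup>\<star> \<otimes> b\<^sup>\<star>)"
    using cl by (simp add: leS_def star_mult_Proj star_Proj)
  also have "\<dots> = b \<otimes> a\<^sup>\<star>" using cl by (metis RR3 RR4 mult_assoc rstar_closed)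
  finally show ?thesis by (simp add: left_compatible_def)
qed

end


lemma boolean_lattice_cong:
  assumes "boolean_lattice L" and c: "carrier L' = carrier L" and e: "eq L' = eq L"
    and le: "\<And>x y. x \<in> carrier L \<Longrightarrow> y \<in> carrier L \<Longrightarrow> x \<sqsubseteq>\<^bsub>L'\<^esub> y \<longleftrightarrow> x \<sqsubseteq>\<^bsub>L\<^esub> y"
  shows "boolean_lattice L'"
proof -
  have U: "Upper L' A = Upper L A" "Lower L' A = Lower L A" for A
    unfolding Upper_def Lower_def c using le by blast+
  have l: "least L' x A \<longleftrightarrow> least L x A" "greatest L' x A \<longleftrightarrow> greatest L x A" for x A
    unfolding least_def greatest_def c using le by (meson subsetD)+
  interpret boolean_lattice L by fact
  have ops: "bottom L' = bottom L" "top L' = top L" "join L' = join L" "meet L' = meet L"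
    by (simp_all add: bottom_def top_def join_def meet_def sup_def inf_def fun_eq_iff l U c)
  have po: "partial_order L'"
  proof
    show "(.=\<^bsub>L'\<^esub>) = (=)" by (simp add: e eq_is_equal)
    fix x y assume xy: "x \<in> carrier L'" "y \<in> carrier L'"
    show "x \<sqsubseteq>\<^bsub>L'\<^esub> x" using xy by (simp add: c le)
    show "x .=\<^bsub>L'\<^esub> x" by (simp add: e eq_is_equal)
    show "y .=\<^bsub>L'\<^esub> x" if "x .=\<^bsub>L'\<^esub> y" using that by (simp add: e eq_is_equal)
    show "x .=\<^bsub>L'\<^esub> y" if "x \<sqsubseteq>\<^bsub>L'\<^esub> y" "y \<sqsubseteq>\<^bsub>L'\<^esub> x"
      using that xy by (simp add: c le e eq_is_equal le_antisym)
    fix z assume z: "z \<in> carrier L'"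
    show "x .=\<^bsub>L'\<^esub> z" if "x .=\<^bsub>L'\<^esub> y" "y .=\<^bsub>L'\<^esub> z" using that by (simp add: e eq_is_equal)
    show "x \<sqsubseteq>\<^bsub>L'\<^esub> z" if "x \<sqsubseteq>\<^bsub>L'\<^esub> y" "y \<sqsubseteq>\<^bsub>L'\<^esub> z"
      using that xy z le_trans[of x y z] by (simp add: c le)
    fix w show "x \<sqsubseteq>\<^bsub>L'\<^esub> z \<longleftrightarrow> y \<sqsubseteq>\<^bsub>L'\<^esub> w" if "x .=\<^bsub>L'\<^esub> y" "z .=\<^bsub>L'\<^esub> w"
      using that by (simp add: e eq_is_equal)
  qed
  interpret L': partial_order L' by (rule po)
  interpret L'1: upper_semilattice L'
    by unfold_locales (simp only: l U c sup_of_two_exists)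
  interpret L'2: lower_semilattice L'
    by unfold_locales (simp only: l U c inf_of_two_exists)
  interpret L'3: bounded_lattice L'
    by unfold_locales (simp_all only: l c bottom_exists top_exists)
  show ?thesis
    by unfold_locales (simp_all only: ops c meet_join_distrib ex_complement)
qed

context boolean_right_restriction_monoid begin

interpretation P: boolean_lattice "Proj_order S" by (rule boolean_Proj)

lemma P_simps [simp]: "carrier (Proj_order S) = Proj S" "x \<sqsubseteq>\<^bsub>Proj_order S\<^esub> y \<longleftrightarrow> leS x y"
  by (auto simp: Proj_order_def natural_order_def leS_def)

abbreviation pj (infixl "\<uplus>" 65) where "e \<uplus> f \<equiv> e \<squnion>\<^bsub>Proj_order S\<^esub> f"

lemma pj: "e \<in> Proj S \<Longrightarrow> f \<in> Proj S \<Longrightarrow> e \<uplus> f \<in> Proj S"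
  "e \<in> Proj S \<Longrightarrow> f \<in> Proj S \<Longrightarrow> leS e (e \<uplus> f)"
  "e \<in> Proj S \<Longrightarrow> f \<in> Proj S \<Longrightarrow> leS f (e \<uplus> f)"
  using P.join_closed[of e f] P.join_left[of e f] P.join_right[of e f] by auto

lemma pj_le: "\<lbrakk>e \<in> Proj S; f \<in> Proj S; g \<in> Proj S; leS e g; leS f g\<rbrakk> \<Longrightarrow> leS (e \<uplus> f) g"
  using P.join_le[of e g f] by auto

lemma Proj_le: "e \<in> Proj S \<Longrightarrow> f \<in> Proj S \<Longrightarrow> leS e f \<longleftrightarrow> e = f \<otimes> e"
  by (simp add: leS_def Proj_star)

lemma pmeet: assumes "e \<in> Proj S" "f \<in> Proj S" shows "e \<sqinter>\<^bsub>Proj_order S\<^esub> f = e \<otimes> f"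
proof -
  have "greatest (Proj_order S) (e \<otimes> f) (Lower (Proj_order S) {e, f})"
    using assms
    apply (auto simp: greatest_def Lower_def Proj_mult)
      apply (simp add: leS_I Proj_carrier)
     apply (simp add: leS_I[of _ f e] Proj_comm Proj_carrier)
    apply (simp add: Proj_le Proj_mult mult_assoc Proj_carrier)
    done
  then show ?thesis unfolding meet_def
    using assms P.inf_of_two_exists[of e f] P.greatest_unique
    by (simp add: inf_def some_equality)
qed

lemma pdistrib: "\<lbrakk>d \<in> Proj S; e \<in> Proj S; f \<in> Proj S\<rbrakk> \<Longrightarrow> d \<otimes> (e \<uplus> f) = (d \<otimes> e) \<uplus> (d \<otimes> f)"
  using P.meet_join_distrib[of d e f] by (simp add: pmeet pj)

lemma ex_lub: "\<lbrakk>a \<in> carrier S; b \<in> carrier S; left_compatible S a b\<rbrakk> \<Longrightarrow> \<exists>j. lubS j a b"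
  using left_compatible_join[of a b] by (simp add: lubS)

lemma lub_right: "\<lbrakk>a \<in> carrier S; b \<in> carrier S; c \<in> carrier S; left_compatible S a b; lubS j a b\<rbrakk>
   \<Longrightarrow> lubS (j \<otimes> c) (a \<otimes> c) (b \<otimes> c)"
  using join_distrib_right[of a b c j] by (simp add: lubS mult_closed)

lemma lub_star:
  assumes "a \<in> carrier S" "b \<in> carrier S" "lubS w a b" "e \<in> Proj S" "leS (a\<^sup>\<star>) e" "leS (b\<^sup>\<star>) e"
  shows "w \<otimes> e = w" "leS (w\<^sup>\<star>) e"
proof -
  have w: "w \<in> carrier S" using assms by (simp add: lubS_def)
  have *: "leS x (w \<otimes> e)" if "x \<in> carrier S" "leS x w" "leS (x\<^sup>\<star>) e" for x
  proof -
    have "x = w \<otimes> x\<^sup>\<star>" using that by (simp add: leS_def)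
    also have "x\<^sup>\<star> = e \<otimes> x\<^sup>\<star>" using that assms(4) star_Proj by (simp add: Proj_le)
    also have "w \<otimes> (e \<otimes> x\<^sup>\<star>) = w \<otimes> e \<otimes> x\<^sup>\<star>"
      using that w assms(4) by (simp add: mult_assoc rstar_closed Proj_carrier)
    finally show ?thesis unfolding leS_def .
  qed
  have we: "w \<otimes> e \<in> carrier S" using w assms(4) by (simp add: mult_closed Proj_carrier)
  have "leS a (w \<otimes> e)" "leS b (w \<otimes> e)"
    using *[of a] *[of b] assms(1,2,5,6) assms(3)[unfolded lubS_def] by blast+
  then have "leS w (w \<otimes> e)" using assms(3) we unfolding lubS_def by blast
  then show 1: "w \<otimes> e = w"
    using leS_antisym[OF w _ _ leS_I[OF refl w assms(4)]] w assms(4)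
    by (simp add: mult_closed Proj_carrier)
  show "leS (w\<^sup>\<star>) e"
    using star_mult_Proj[OF w assms(4)] 1 Proj_comm[OF star_Proj[OF w] assms(4)]
      Proj_le[OF star_Proj[OF w] assms(4)] by simp
qed

lemma le_by_cover:
  assumes "z \<in> carrier S" "u \<in> carrier S" "e \<in> Proj S" "f \<in> Proj S"
    "z \<otimes> (e \<uplus> f) = z" "leS (z \<otimes> e) u" "leS (z \<otimes> f) u"
  shows "leS z u"
proof -
  have cl: "e \<in> carrier S" "f \<in> carrier S" "z \<otimes> e \<in> carrier S" "z \<otimes> f \<in> carrier S"
    using assms by (auto simp: Proj_carrier mult_closed)
  have "left_compatible S (z \<otimes> e) (z \<otimes> f)"
    unfolding left_compatible_def using assms cl
    by (simp add: star_mult_Proj mult_assoc rr_closed)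
      (metis Proj_comm Proj_mult mult_assoc star_Proj rstar_closed)
  then obtain w where w: "lubS w (z \<otimes> e) (z \<otimes> f)" using ex_lub cl by blast
  then have wc: "w \<in> carrier S" by (simp add: lubS_def)
  have wz: "leS w z" "leS w u" using w assms leS_I by (auto simp: lubS_def)
  have "leS (z\<^sup>\<star> \<otimes> e) (w\<^sup>\<star>)" "leS (z\<^sup>\<star> \<otimes> f) (w\<^sup>\<star>)"
    using w leS_star[OF cl(3) wc] leS_star[OF cl(4) wc] assms wc
    by (auto simp: lubS_def star_mult_Proj Proj_le Proj_mult star_Proj)
  then have "leS (z\<^sup>\<star> \<otimes> (e \<uplus> f)) (w\<^sup>\<star>)"
    using assms wc by (simp add: pdistrib star_Proj pj_le Proj_mult)
  moreover have "z\<^sup>\<star> \<otimes> (e \<uplus> f) = z\<^sup>\<star>"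
    using assms star_mult_Proj[of z "e \<uplus> f"] by (simp add: pj)
  ultimately have "z\<^sup>\<star> = w\<^sup>\<star> \<otimes> z\<^sup>\<star>" using assms wc by (simp add: Proj_le star_Proj)
  then have "z = w" using wz(1) wc assms(1) leS_star[OF wc assms(1) wz(1)]
    unfolding leS_def by (metis RR3 RR4)
  then show ?thesis using wz by simp
qed

lemma lub_left:
  assumes "a \<in> carrier S" "b \<in> carrier S" "c \<in> carrier S" "lubS j b c"
  shows "lubS (a \<otimes> j) (a \<otimes> b) (a \<otimes> c)"
proof -
  have j: "j \<in> carrier S" "leS b j" "leS c j" using assms by (auto simp: lubS_def)
  have b: "b\<^sup>\<star> \<in> Proj S" "c\<^sup>\<star> \<in> Proj S" using assms star_Proj by auto
  note pbc = pj(1)[OF b] pj(2)[OF b] pj(3)[OF b]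
  have je: "j \<otimes> (b\<^sup>\<star> \<uplus> c\<^sup>\<star>) = j" by (rule lub_star(1)[OF assms(2-4) pbc])
  have jb: "j \<otimes> b\<^sup>\<star> = b" "j \<otimes> c\<^sup>\<star> = c" using j(2,3) unfolding leS_def by simp_all
  have aj: "a \<otimes> j \<otimes> e = a \<otimes> (j \<otimes> e)" if "e \<in> Proj S" for e
    by (rule mult_assoc[OF assms(1) j(1) Proj_carrier[OF that]])
  have cl: "a \<otimes> j \<in> carrier S" "a \<otimes> b \<in> carrier S" "a \<otimes> c \<in> carrier S"
    using assms(1-3) j(1) by (simp_all add: mult_closed)
  have "leS (a \<otimes> j) u" if u: "u \<in> carrier S" "leS (a \<otimes> b) u" "leS (a \<otimes> c) u" for u
  proof (rule le_by_cover[OF cl(1) u(1) b])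
    show "a \<otimes> j \<otimes> (b\<^sup>\<star> \<uplus> c\<^sup>\<star>) = a \<otimes> j" by (simp only: aj[OF pbc(1)] je)
    show "leS (a \<otimes> j \<otimes> b\<^sup>\<star>) u" by (simp only: aj[OF b(1)] jb u)
    show "leS (a \<otimes> j \<otimes> c\<^sup>\<star>) u" by (simp only: aj[OF b(2)] jb u)
  qed
  moreover have "leS (a \<otimes> b) (a \<otimes> j)" "leS (a \<otimes> c) (a \<otimes> j)"
    by (rule leS_mult_left[OF assms(2) j(1) assms(1) j(2)] leS_mult_left[OF assms(3) j(1) assms(1) j(3)])+
  ultimately show ?thesis using cl(1) unfolding lubS_def by blast
qed

lemma lub_pinv_aux:
  assumes p: "pinv a a'" "pinv b b'" and P: "a \<otimes> b' \<in> Proj S" "a' \<otimes> b \<in> Proj S"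
    and j: "lubS j a b" and k: "lubS k a' b'"
  shows "j \<otimes> k = k\<^sup>\<star>"
proof -
  have cl: "a \<in> carrier S" "b \<in> carrier S" "a' \<in> carrier S" "b' \<in> carrier S" "j \<in> carrier S" "k \<in> carrier S"
    using assms by (auto simp: pinv_def lubS_def)
  have ks: "k\<^sup>\<star> \<in> Proj S" using cl star_Proj by simp
  have eq: "b \<otimes> a' = a \<otimes> b'"
    using is_inverse_unique[OF pinv_Proj[OF P(1)] pinv_is_inverse[OF pinv_mult[OF p(1) pinv_sym[OF p(2)]]]] .
  have lk: "leS (a'\<^sup>\<star>) (k\<^sup>\<star>)" "leS (b'\<^sup>\<star>) (k\<^sup>\<star>)"
    using leS_star[of a' k] leS_star[of b' k] cl k[unfolded lubS_def]
      Proj_le[OF star_Proj[OF cl(3)] ks] Proj_le[OF star_Proj[OF cl(4)] ks] by blast+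
  have "leS (a \<otimes> b') (b'\<^sup>\<star>)"
  proof -
    have "a \<otimes> b' = a \<otimes> b' \<otimes> b'\<^sup>\<star>" using cl by (simp add: mult_assoc rstar_closed RR4)
    also have "\<dots> = b'\<^sup>\<star> \<otimes> (a \<otimes> b')" by (rule Proj_comm[OF P(1) star_Proj[OF cl(4)]])
    finally show ?thesis using Proj_le[OF P(1) star_Proj[OF cl(4)]] by simp
  qed
  then have ab: "leS (a \<otimes> b') (k\<^sup>\<star>)"
    using leS_trans[OF rstar_closed[OF cl(4)] rstar_closed[OF cl(6)] Proj_carrier[OF P(1)]] lk(2)
    by simp
  have L: "lubS (a \<otimes> k) (a \<otimes> a') (a \<otimes> b')" "lubS (b \<otimes> k) (b \<otimes> a') (b \<otimes> b')"
    "lubS (j \<otimes> k) (a \<otimes> k) (b \<otimes> k)"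
    by (rule lub_left[OF cl(1,3,4) k] lub_left[OF cl(2,3,4) k]
      lub_right[OF cl(1,2,6) compatible_left[OF p P(1)] j])+
  have clk: "j \<otimes> k \<in> carrier S" "a \<otimes> k \<in> carrier S" "b \<otimes> k \<in> carrier S" "k\<^sup>\<star> \<in> carrier S"
    "a \<otimes> a' \<in> carrier S" "b \<otimes> b' \<in> carrier S"
    using cl by (simp_all add: mult_closed rstar_closed)
  have aa: "a \<otimes> a' = a'\<^sup>\<star>" "b \<otimes> b' = b'\<^sup>\<star>" using p by (auto simp: pinv_def)
  have "leS (a \<otimes> k) (k\<^sup>\<star>)" "leS (b \<otimes> k) (k\<^sup>\<star>)"
    using L(1,2) lk ab clk unfolding lubS_def aa eq by blast+
  then have 1: "leS (j \<otimes> k) (k\<^sup>\<star>)" using L(3) clk unfolding lubS_def by blast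
  then have jk: "j \<otimes> k \<in> Proj S" using leS_Proj[OF clk(1) ks] by simp
  have "leS (a \<otimes> a') (j \<otimes> k)"
    using leS_trans[OF clk(2,1,5)] L unfolding lubS_def by blast
  moreover have "leS (b \<otimes> b') (j \<otimes> k)"
    using leS_trans[OF clk(3,1,6)] L unfolding lubS_def by blast
  ultimately have "leS (k\<^sup>\<star>) (j \<otimes> k)" using lub_star(2)[OF cl(3,4) k jk] aa by simp
  with 1 show ?thesis using leS_antisym[OF clk(1,4)] by simp
qed

lemma lub_pinv:
  assumes p: "pinv a a'" "pinv b b'" and P: "a \<otimes> b' \<in> Proj S" "a' \<otimes> b \<in> Proj S"
    and j: "lubS j a b"
  shows "j \<in> carrier (Inv S)"
proof -
  obtain k where k: "lubS k a' b'"
    using compatible_left[OF pinv_sym[OF p(1)] pinv_sym[OF p(2)] P(2)] ex_lub p by (auto simp: pinv_def)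
  have "pinv j k"
    using lub_pinv_aux[OF p P j k] lub_pinv_aux[OF pinv_sym[OF p(1)] pinv_sym[OF p(2)] P(2,1) k j] j k
    by (auto simp: pinv_def lubS_def)
  then show ?thesis by (rule pinv_Inv)
qed

lemma compatibleD:
  assumes "a \<in> carrier (Inv S)" "b \<in> carrier (Inv S)" "compatible (Inv S) a b"
  obtains a' b' where "pinv a a'" "pinv b b'" "a \<otimes> b' \<in> Proj S" "a' \<otimes> b \<in> Proj S"
proof -
  obtain a' b' where p: "pinv a a'" "pinv b b'" using assms unfolding Inv_pinv by blast
  then show ?thesis using that[of a' b'] assms(3)
    unfolding compatible_def Idem_Inv im_inv_Inv[OF p(1)] im_inv_Inv[OF p(2)] by (simp add: Inv_def)
qed

lemma im_lubI:
  assumes "a \<in> carrier (Inv S)" "b \<in> carrier (Inv S)" "j \<in> carrier (Inv S)" "lubS j a b"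
  shows "is_lub (im_order (Inv S)) j {a, b}"
  using assms by (auto simp: least_def Upper_def im_carrier im_le lubS_def Inv_carrier)

lemma im_lub:
  assumes "a \<in> carrier (Inv S)" "b \<in> carrier (Inv S)" "compatible (Inv S) a b"
  shows "\<exists>j. lubS j a b \<and> left_compatible S a b \<and> j \<in> carrier (Inv S) \<and>
    (\<forall>i. is_lub (im_order (Inv S)) i {a, b} \<longleftrightarrow> i = j)"
proof -
  obtain a' b' where p: "pinv a a'" "pinv b b'" "a \<otimes> b' \<in> Proj S" "a' \<otimes> b \<in> Proj S"
    using compatibleD[OF assms] .
  have lc: "left_compatible S a b" using compatible_left p by blast
  then obtain j where j: "lubS j a b" using ex_lub assms Inv_carrier by blast
  have jI: "j \<in> carrier (Inv S)" using lub_pinv p j by blast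
  have lj: "is_lub (im_order (Inv S)) j {a, b}" using im_lubI assms jI j by blast
  have "i = j" if "is_lub (im_order (Inv S)) i {a, b}" for i
  proof -
    have i: "i \<in> carrier (Inv S)" using that by (auto simp: least_def Upper_def im_carrier)
    have "leS i j" "leS j i"
      using that lj i jI im_le unfolding least_def by auto
    then show ?thesis using leS_antisym i jI Inv_carrier by blast
  qed
  then show ?thesis using j lc jI lj by blast
qed

theorem boolean_inverse_monoid_Inv: "boolean_inverse_monoid (Inv S)"
proof -
  interpret I: inverse_monoid "Inv S" by (rule inverse_monoid_Inv)
  have m: "x \<otimes>\<^bsub>Inv S\<^esub> y = x \<otimes> y" for x y by (simp add: Inv_def)
  show ?thesis
  proof (intro boolean_inverse_monoid.intro boolean_inverse_monoid_axioms.intro inverse_monoid_Inv)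
    have bP: "\<bottom>\<^bsub>Proj_order S\<^esub> \<in> Proj S" using P.bottom_closed by simp
    show "\<exists>z\<in>carrier (Inv S). \<forall>a\<in>carrier (Inv S). z \<otimes>\<^bsub>Inv S\<^esub> a = z \<and> a \<otimes>\<^bsub>Inv S\<^esub> z = z"
      using bottom_zero Inv_carrier pinv_Inv(1)[OF pinv_Proj[OF bP]] unfolding m by blast
  next
    fix a b assume ab: "a \<in> carrier (Inv S)" "b \<in> carrier (Inv S)" "compatible (Inv S) a b"
    show "\<exists>j. is_lub (im_order (Inv S)) j {a, b}" using im_lub[OF ab] by blast
    fix c j assume c: "c \<in> carrier (Inv S)" and "is_lub (im_order (Inv S)) j {a, b}"
    then have "lubS j a b" "left_compatible S a b" "j \<in> carrier (Inv S)" using im_lub[OF ab] by auto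
    then show "is_lub (im_order (Inv S)) (j \<otimes>\<^bsub>Inv S\<^esub> c) {a \<otimes>\<^bsub>Inv S\<^esub> c, b \<otimes>\<^bsub>Inv S\<^esub> c}"
      "is_lub (im_order (Inv S)) (c \<otimes>\<^bsub>Inv S\<^esub> j) {c \<otimes>\<^bsub>Inv S\<^esub> a, c \<otimes>\<^bsub>Inv S\<^esub> b}"
      unfolding m
      using ab(1,2) c lub_right[of a b c j] lub_left[of c a b j] I.m_closed[unfolded m]
      by (simp_all add: im_lubI Inv_carrier)
  next
    show "boolean_lattice (im_order (Inv S)\<lparr>carrier := Idempotents (Inv S)\<rparr>)"
    proof (rule boolean_lattice_cong[OF boolean_Proj])
      fix x y assume "x \<in> carrier (Proj_order S)"
      then have "x \<in> carrier (Inv S)" using pinv_Proj pinv_Inv by auto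
      then show "x \<sqsubseteq>\<^bsub>im_order (Inv S)\<lparr>carrier := Idempotents (Inv S)\<rparr>\<^esub> y \<longleftrightarrow> x \<sqsubseteq>\<^bsub>Proj_order S\<^esub> y"
        using im_le by simp
    qed (simp_all add: Idem_Inv, simp add: natural_order_def Proj_order_def)
  qed
qed

end

end

theory Submission
  imports Defs
begin

text \<open>
  Every element of an etale monoid is a finite join of partial units, so a homomorphism that
  preserves finite left-compatible joins is determined by its restriction \<open>\<theta>\<close> to the partial
  units: it must send \<open>a = \<Or>A\<close> to \<open>\<Or>\<theta>(A)\<close>. This gives uniqueness, and it is also the recipe for
  the extension. Two points need proof.

  The join \<open>\<Or>\<theta>(A)\<close> exists. Elements with a common upper bound are left-compatible, the relation
  \<open>a b\<^sup>\<star> = b a\<^sup>\<star>\<close> between partial units is written with products and \<open>a\<^sup>\<star> = a\<inverse>a\<close> only, and so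
  \<open>\<theta>\<close> preserves it. In a Boolean right restriction monoid finite left-compatible sets have joins
  (\<open>finite_left_compatible_lub\<close>).

  It does not depend on \<open>A\<close>. The key fact (\<open>theta_le_upper_bound\<close>) is that any partial unit
  \<open>x \<le> \<Or>A\<close> satisfies \<open>\<theta>(x) \<le> \<Or>\<theta>(A)\<close>. Indeed \<open>x = (\<Or>A) x\<^sup>\<star>\<close> is the join of the elements \<open>y x\<^sup>\<star>\<close>
  with \<open>y \<in> A\<close>. These lie below the partial unit \<open>x\<close>, hence they are compatible partial units and
  this join is one that \<open>\<theta>\<close> respects: \<open>\<theta>(x)\<close> is the join of the
  \<open>\<theta>(y x\<^sup>\<star>) = \<theta>(y) \<theta>(x)\<^sup>\<star> \<le> \<theta>(y)\<close>. A small gap has to be closed here: \<open>\<theta>\<close> produces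
  joins inside \<open>Inv(T)\<close>, but the argument compares with arbitrary elements of \<open>T\<close>. The partial units
  are downward closed, so the join in \<open>T\<close> of a finite set bounded by a partial unit is itself a
  partial unit, and both joins agree (\<open>im_lub_lub\<close>).

  Consequently \<open>\<Or>\<theta>(A)\<close> is the join of the images of all partial units below \<open>a\<close>, a description
  in which \<open>A\<close> no longer occurs. Since finite joins commute with products on both sides and with
  \<open>\<star>\<close>, the extension is a homomorphism, and it preserves joins because a join of joins is the join
  of the union.

  For the second part, the inverse of an isomorphism \<open>\<theta>\<close> preserves the order and hence all joins,
  so it extends as well. The two extensions are mutually inverse, since
  \<open>\<Or>A \<mapsto> \<Or>\<theta>(A) \<mapsto> \<Or>\<theta>\<inverse>(\<theta>(A)) = \<Or>A\<close>.
\<close>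

section \<open>Joins in the natural order\<close>

context right_restriction_monoid begin

abbreviation "lub j A \<equiv> is_lub (natural_order S) j A"

lemma lub_iff:
  assumes "A \<subseteq> carrier S"
  shows "lub j A \<longleftrightarrow> j \<in> carrier S \<and> (\<forall>a\<in>A. leS a j) \<and>
    (\<forall>u\<in>carrier S. (\<forall>a\<in>A. leS a u) \<longrightarrow> leS j u)"
proof -
  have "Upper (natural_order S) A = {u \<in> carrier S. \<forall>a\<in>A. leS a u}"
    using assms by (auto simp: Upper_def natural_order_def leS_def)
  then show ?thesis by (auto simp: least_def natural_order_def leS_def)
qed

lemma lub_closed: "lub j A \<Longrightarrow> j \<in> carrier S"
  by (auto simp: least_def Upper_def natural_order_def)

lemma lub_upper: "\<lbrakk>lub j A; A \<subseteq> carrier S; a \<in> A\<rbrakk> \<Longrightarrow> leS a j"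
  by (simp add: lub_iff)

lemma lub_least: "\<lbrakk>lub j A; A \<subseteq> carrier S; u \<in> carrier S; \<And>a. a \<in> A \<Longrightarrow> leS a u\<rbrakk> \<Longrightarrow> leS j u"
  by (simp add: lub_iff)

lemma lub_unique: "\<lbrakk>lub i A; lub j A; A \<subseteq> carrier S\<rbrakk> \<Longrightarrow> i = j"
  by (simp add: lub_iff leS_antisym)

lemma lub_singleton: "a \<in> carrier S \<Longrightarrow> lub a {a}"
  by (simp add: lub_iff leS_refl)

lemma leS_mult_star: "\<lbrakk>a \<in> carrier S; b \<in> carrier S\<rbrakk> \<Longrightarrow> leS (a \<otimes> b\<^sup>\<star>) a"
  using leS_I star_Proj by blast

lemma leS_star_mono: "\<lbrakk>a \<in> carrier S; b \<in> carrier S; leS a b\<rbrakk> \<Longrightarrow> leS (a\<^sup>\<star>) (b\<^sup>\<star>)"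
  using leS_star[of a b] by (simp add: leS_def RR1)

text \<open>Both products equal \<open>u\<close> times the product of the two commuting projections. In particular
  a set that has a join is left-compatible.\<close>

lemma bounded_left_compatible:
  assumes "a \<in> carrier S" "b \<in> carrier S" "u \<in> carrier S" "leS a u" "leS b u"
  shows "left_compatible S a b"
proof -
  have "a \<otimes> b\<^sup>\<star> = u \<otimes> (a\<^sup>\<star> \<otimes> b\<^sup>\<star>)" "b \<otimes> a\<^sup>\<star> = u \<otimes> (b\<^sup>\<star> \<otimes> a\<^sup>\<star>)"
    using assms mult_assoc[of u "a\<^sup>\<star>" "b\<^sup>\<star>"] mult_assoc[of u "b\<^sup>\<star>" "a\<^sup>\<star>"]
    by (simp_all add: rstar_closed leS_def)
  then show ?thesis using assms RR3[of a b] by (simp add: left_compatible_def)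
qed

text \<open>A join of joins is the join of the union, because a union and the set of its partial joins
  have the same upper bounds. Read in both directions, this regroups a family of joins.\<close>

lemma lub_UN:
  assumes "\<And>i. i \<in> I \<Longrightarrow> G i \<subseteq> carrier S" "\<And>i. i \<in> I \<Longrightarrow> lub (f i) (G i)"
  shows "lub j (\<Union>i\<in>I. G i) \<longleftrightarrow> lub j (f ` I)"
proof -
  have f: "f i \<in> carrier S" if "i \<in> I" for i using assms(2) that lub_closed by blast
  have "(\<forall>x\<in>G i. leS x u) \<longleftrightarrow> leS (f i) u" if "i \<in> I" "u \<in> carrier S" for i u
    using that f[OF that(1)] assms(1)[OF that(1)] assms(2)[OF that(1)]
      leS_trans[of "f i" u] lub_upper[of "f i" "G i"] lub_least[of "f i" "G i" u]
    by (meson subsetD)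
  then have *: "(\<forall>x\<in>\<Union>i\<in>I. G i. leS x u) \<longleftrightarrow> (\<forall>x\<in>f ` I. leS x u)" if "u \<in> carrier S" for u
    using that by auto
  have "(\<Union>i\<in>I. G i) \<subseteq> carrier S" "f ` I \<subseteq> carrier S" using assms(1) f by auto
  then show ?thesis by (simp only: lub_iff * cong: conj_cong ball_cong)
qed

lemma lub_insert:
  assumes "A \<subseteq> carrier S" "b \<in> carrier S" "lub j A" "lub k {b, j}"
  shows "lub k (insert b A)"
proof -
  \<comment> \<open>The two-member index set collapses when \<open>A = {b}\<close>; then \<open>j = b\<close>.\<close>
  have "lub k (\<Union>X\<in>{{b}, A}. X) \<longleftrightarrow> lub k ((\<lambda>X. if X = A then j else b) ` {{b}, A})"
    using assms lub_singleton by (intro lub_UN) auto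
  moreover have "(\<lambda>X. if X = A then j else b) ` {{b}, A} = {b, j}" if "A \<noteq> {b}"
    using that by auto
  moreover have "j = b" if "A = {b}"
    using that assms lub_unique lub_singleton by blast
  ultimately show ?thesis using assms by (cases "A = {b}") auto
qed

end

context boolean_right_restriction_monoid begin

abbreviation zeroS where "zeroS \<equiv> \<bottom>\<^bsub>Proj_order S\<^esub>"

lemma zero_Proj: "zeroS \<in> Proj S"
proof -
  interpret P: boolean_lattice "Proj_order S" by (rule boolean_Proj)
  show ?thesis using P.bottom_closed by simp
qed

lemma zero_closed: "zeroS \<in> carrier S"
  by (rule Proj_carrier[OF zero_Proj])

lemma zero_star: "zeroS\<^sup>\<star> = zeroS"
  by (rule Proj_star[OF zero_Proj])

lemma lub_empty: "lub zeroS {}"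
  using bottom_zero by (subst lub_iff) (simp_all add: zero_closed leS_def zero_star)

text \<open>The join of the stars need not be a projection a priori, but it lies below the projection
  \<open>j\<^sup>\<star>\<close> and elements below projections are projections; \<open>lub_star\<close> then bounds \<open>j\<^sup>\<star>\<close> by it.\<close>

lemma lub_star2:
  assumes "a \<in> carrier S" "b \<in> carrier S" "lubS j a b"
  shows "lubS (j\<^sup>\<star>) (a\<^sup>\<star>) (b\<^sup>\<star>)"
proof -
  have j: "j \<in> carrier S" "leS a j" "leS b j" using assms(3) by (auto simp: lubS_def)
  have cl: "a\<^sup>\<star> \<in> carrier S" "b\<^sup>\<star> \<in> carrier S" "j\<^sup>\<star> \<in> carrier S"
    using assms j rstar_closed by auto
  have up: "leS (a\<^sup>\<star>) (j\<^sup>\<star>)" "leS (b\<^sup>\<star>) (j\<^sup>\<star>)"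
    using leS_star_mono assms(1,2) j by auto
  have "left_compatible S (a\<^sup>\<star>) (b\<^sup>\<star>)" using bounded_left_compatible cl up by blast
  then obtain w where w: "lubS w (a\<^sup>\<star>) (b\<^sup>\<star>)" using ex_lub cl by blast
  then have wj: "w \<in> carrier S" "leS w (j\<^sup>\<star>)" using cl up by (auto simp: lubS_def)
  then have wP: "w \<in> Proj S" using leS_Proj[OF _ star_Proj[OF j(1)]] by simp
  have "leS (j\<^sup>\<star>) w" using lub_star(2)[OF assms wP] w by (simp add: lubS_def)
  then have "j\<^sup>\<star> = w" using leS_antisym[of "j\<^sup>\<star>" w] wj cl by simp
  then show ?thesis using w by simp
qed

text \<open>Distributivity turns \<open>j c\<^sup>\<star>\<close> and \<open>c j\<^sup>\<star>\<close> into the joins of \<open>{a c\<^sup>\<star>, b c\<^sup>\<star>}\<close> and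
  \<open>{c a\<^sup>\<star>, c b\<^sup>\<star>}\<close>, which are the same set.\<close>

lemma left_compatible_join2:
  assumes "a \<in> carrier S" "b \<in> carrier S" "c \<in> carrier S" "lubS j a b"
    and "left_compatible S c a" "left_compatible S c b"
  shows "left_compatible S c j"
proof -
  have j: "j \<in> carrier S" "leS a j" "leS b j" using assms(4) by (auto simp: lubS_def)
  have "left_compatible S a b" using bounded_left_compatible[OF assms(1,2) j] .
  then have "lubS (j \<otimes> c\<^sup>\<star>) (a \<otimes> c\<^sup>\<star>) (b \<otimes> c\<^sup>\<star>)"
    using lub_right[OF assms(1,2) rstar_closed[OF assms(3)] _ assms(4)] by simp
  moreover have "lubS (c \<otimes> j\<^sup>\<star>) (c \<otimes> a\<^sup>\<star>) (c \<otimes> b\<^sup>\<star>)"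
    using lub_left[OF assms(3) rstar_closed[OF assms(1)] rstar_closed[OF assms(2)]]
      lub_star2[OF assms(1,2,4)] by simp
  moreover have "c \<otimes> a\<^sup>\<star> = a \<otimes> c\<^sup>\<star>" "c \<otimes> b\<^sup>\<star> = b \<otimes> c\<^sup>\<star>"
    using assms(5,6) by (auto simp: left_compatible_def)
  ultimately have j2: "lubS (j \<otimes> c\<^sup>\<star>) (a \<otimes> c\<^sup>\<star>) (b \<otimes> c\<^sup>\<star>)"
    "lubS (c \<otimes> j\<^sup>\<star>) (a \<otimes> c\<^sup>\<star>) (b \<otimes> c\<^sup>\<star>)" by simp_all
  have "c \<otimes> j\<^sup>\<star> = j \<otimes> c\<^sup>\<star>"
    by (rule leS_antisym; use j2 in \<open>unfold lubS_def, blast\<close>)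
  then show ?thesis by (simp add: left_compatible_def)
qed

text \<open>Only binary joins are given. The join of part of the set can be joined with the next
  element only if these two are left-compatible, so the induction also carries that the join
  inherits left-compatibility with any element.\<close>

lemma finite_left_compatible_lub:
  assumes "finite A" "A \<subseteq> carrier S" "\<And>a b. a \<in> A \<Longrightarrow> b \<in> A \<Longrightarrow> left_compatible S a b"
  shows "\<exists>j. lub j A"
proof -
  have "\<exists>j. lub j A \<and> (\<forall>c\<in>carrier S. (\<forall>a\<in>A. left_compatible S c a) \<longrightarrow> left_compatible S c j)"
    using assms
  proof (induction A)
    case empty
    then show ?case using lub_empty bottom_zero
      by (intro exI[of _ zeroS]) (simp add: left_compatible_def zero_star rstar_closed)
  next
    case (insert b A)
    then obtain j where j: "lub j A"
      "\<And>c. c \<in> carrier S \<Longrightarrow> (\<forall>a\<in>A. left_compatible S c a) \<Longrightarrow> left_compatible S c j"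
      by auto
    have cl: "b \<in> carrier S" "j \<in> carrier S" using insert.prems(1) lub_closed j(1) by auto
    have "left_compatible S b j" using j(2) cl insert.prems by simp
    then obtain k where k: "lubS k b j" using ex_lub cl by blast
    then have "lub k {b, j}" using lubS cl by simp
    then have "lub k (insert b A)" using lub_insert insert.prems(1) j(1) by simp
    moreover have "left_compatible S c k"
      if "c \<in> carrier S" "\<forall>a\<in>insert b A. left_compatible S c a" for c
      using left_compatible_join2[OF cl that(1) k] j(2)[OF that(1)] that(2) by simp
    ultimately show ?case by blast
  qed
  then show ?thesis by blast
qed

text \<open>Preservation of \<open>0\<close> and of binary joins gives preservation of finite joins. The joins of all
  subsets of \<open>A\<close> stay below \<open>j\<close>, which makes the binary joins met in the induction exist.\<close>

lemma finite_lub_image: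
  assumes "finite A" "A \<subseteq> carrier S" "lub j A"
    and f: "f \<in> carrier S \<rightarrow> carrier S" "f zeroS = zeroS"
      "\<And>a b k. \<lbrakk>a \<in> carrier S; b \<in> carrier S; lubS k a b\<rbrakk> \<Longrightarrow> lubS (f k) (f a) (f b)"
  shows "lub (f j) (f ` A)"
proof -
  have "\<exists>k. lub k B \<and> lub (f k) (f ` B)" if "finite B" "B \<subseteq> A" for B
    using that
  proof (induction B)
    case empty
    then show ?case using lub_empty f(2) by (intro exI[of _ zeroS]) simp
  next
    case (insert b B)
    then obtain i where i: "lub i B" "lub (f i) (f ` B)" by auto
    have B: "B \<subseteq> carrier S" "b \<in> carrier S" "leS b j"
      using insert.prems assms(2) lub_upper[OF assms(3,2)] by auto
    have ic: "i \<in> carrier S" "j \<in> carrier S" using i(1) assms(3) lub_closed by auto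
    have "leS i j" using lub_least[OF i(1) B(1) ic(2)] lub_upper[OF assms(3,2)] insert.prems by auto
    then have "left_compatible S b i" using bounded_left_compatible B(2,3) ic by blast
    then obtain k where k: "lubS k b i" using ex_lub B(2) ic(1) by blast
    have fc: "f ` B \<subseteq> carrier S" "f b \<in> carrier S" "f i \<in> carrier S"
      using f(1) B ic by auto
    have "lub k {b, i}" "lub (f k) {f b, f i}"
      using k f(3) lubS B(2) ic(1) fc by auto
    then have "lub k (insert b B)" "lub (f k) (insert (f b) (f ` B))"
      using lub_insert[OF B(1,2) i(1)] lub_insert[OF fc(1,2) i(2)] by auto
    then show ?case by auto
  qed
  from this[OF assms(1) subset_refl] show ?thesis
    using lub_unique[OF assms(3) _ assms(2)] by blast
qed

lemma lubS_bounded: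
  assumes "a \<in> carrier S" "b \<in> carrier S" "lubS k a b"
  shows "left_compatible S a b"
  using assms bounded_left_compatible[of a b k] by (auto simp: lubS_def)

lemma finite_lub_mult_right:
  assumes "finite A" "A \<subseteq> carrier S" "lub j A" "c \<in> carrier S"
  shows "lub (j \<otimes> c) ((\<lambda>a. a \<otimes> c) ` A)"
  using assms bottom_zero lub_right lubS_bounded
  by (intro finite_lub_image) (auto simp: mult_closed)

lemma finite_lub_mult_left:
  assumes "finite A" "A \<subseteq> carrier S" "lub j A" "c \<in> carrier S"
  shows "lub (c \<otimes> j) ((\<lambda>a. c \<otimes> a) ` A)"
  using assms bottom_zero lub_left
  by (intro finite_lub_image) (auto simp: mult_closed)

lemma finite_lub_star:
  assumes "finite A" "A \<subseteq> carrier S" "lub j A"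
  shows "lub (j\<^sup>\<star>) (rstar S ` A)"
  using assms lub_star2 by (intro finite_lub_image) (auto simp: zero_star rstar_closed)

lemma finite_lub_mult:
  assumes "finite A" "A \<subseteq> carrier S" "lub a A" "finite B" "B \<subseteq> carrier S" "lub b B"
  shows "lub (a \<otimes> b) (\<Union>x\<in>A. (\<lambda>y. x \<otimes> y) ` B)"
proof -
  have "b \<in> carrier S" using assms lub_closed by blast
  then have "lub (a \<otimes> b) ((\<lambda>x. x \<otimes> b) ` A)" using assms finite_lub_mult_right by blast
  moreover have "lub (x \<otimes> b) ((\<lambda>y. x \<otimes> y) ` B)" if "x \<in> A" for x
    using finite_lub_mult_left assms that by blast
  ultimately show ?thesis
    using assms by (subst lub_UN[where f = "\<lambda>x. x \<otimes> b"]) (auto simp: mult_closed)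
qed

end

section \<open>Joins of partial units\<close>

context right_restriction_monoid begin

lemma Proj_Inv: "e \<in> Proj S \<Longrightarrow> e \<in> carrier (Inv S)"
  using pinv_Inv(1) pinv_Proj by blast

lemma Inv_mult: "\<lbrakk>a \<in> carrier (Inv S); b \<in> carrier (Inv S)\<rbrakk> \<Longrightarrow> a \<otimes> b \<in> carrier (Inv S)"
  unfolding Inv_pinv using pinv_mult by blast

lemma Inv_star: "a \<in> carrier (Inv S) \<Longrightarrow> a\<^sup>\<star> \<in> carrier (Inv S)"
  using Inv_carrier Proj_Inv star_Proj by blast

text \<open>An element below \<open>x\<close> is \<open>x\<close> times a projection, and projections are partial units.\<close>

lemma Inv_downward:
  assumes "x \<in> carrier (Inv S)" "leS a x" "a \<in> carrier S"
  shows "a \<in> carrier (Inv S)"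
  using Inv_mult[of x "a\<^sup>\<star>"] Proj_Inv[of "a\<^sup>\<star>"] assms star_Proj by (simp add: leS_def)

text \<open>The second factor is the inverse of the first.\<close>

lemma pinv_sandwich_Proj:
  assumes "pinv x x'" "g \<in> Proj S"
  shows "(x \<otimes> g) \<otimes> (g \<otimes> x') \<in> Proj S"
proof -
  have "pinv (x \<otimes> g) (g \<otimes> x')" using pinv_mult assms pinv_Proj by blast
  then show ?thesis using star_Proj by (simp add: pinv_def)
qed

text \<open>With \<open>a = x a\<^sup>\<star>\<close>, \<open>b = x b\<^sup>\<star>\<close> and \<open>g = a\<^sup>\<star> b\<^sup>\<star>\<close>, the element \<open>a b\<inverse>\<close> is the conjugate
  \<open>x g x\<inverse>\<close> of a projection, and \<open>a\<inverse> b\<close> is the projection \<open>a\<^sup>\<star> x\<^sup>\<star> b\<^sup>\<star>\<close>.\<close>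

lemma bounded_compatible:
  assumes "x \<in> carrier (Inv S)" "a \<in> carrier S" "b \<in> carrier S" "leS a x" "leS b x"
  shows "compatible (Inv S) a b"
proof -
  obtain x' where x: "pinv x x'" using assms(1) Inv_pinv by blast
  have e: "a\<^sup>\<star> \<in> Proj S" "b\<^sup>\<star> \<in> Proj S" using assms star_Proj by auto
  have ab: "x \<otimes> a\<^sup>\<star> = a" "x \<otimes> b\<^sup>\<star> = b" using assms by (simp_all add: leS_def)
  have cl: "x \<in> carrier S" "x' \<in> carrier S" "a\<^sup>\<star> \<in> carrier S" "b\<^sup>\<star> \<in> carrier S"
    using x e Proj_carrier by (auto simp: pinv_def)
  have p: "pinv a (a\<^sup>\<star> \<otimes> x')" "pinv b (b\<^sup>\<star> \<otimes> x')"
    using pinv_mult[OF x pinv_Proj[OF e(1)]] pinv_mult[OF x pinv_Proj[OF e(2)]]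
    unfolding ab by auto
  have "a \<otimes> (b\<^sup>\<star> \<otimes> x') = x \<otimes> ((a\<^sup>\<star> \<otimes> b\<^sup>\<star>) \<otimes> x')"
    using arg_cong[OF ab(1), of "\<lambda>z. z \<otimes> (b\<^sup>\<star> \<otimes> x')"] cl by (simp add: mult_assoc mult_closed)
  also have "a\<^sup>\<star> \<otimes> b\<^sup>\<star> = (a\<^sup>\<star> \<otimes> b\<^sup>\<star>) \<otimes> (a\<^sup>\<star> \<otimes> b\<^sup>\<star>)"
    using Proj_idem[OF Proj_mult[OF e]] by simp
  also have "x \<otimes> (((a\<^sup>\<star> \<otimes> b\<^sup>\<star>) \<otimes> (a\<^sup>\<star> \<otimes> b\<^sup>\<star>)) \<otimes> x')
      = (x \<otimes> (a\<^sup>\<star> \<otimes> b\<^sup>\<star>)) \<otimes> ((a\<^sup>\<star> \<otimes> b\<^sup>\<star>) \<otimes> x')"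
    using cl by (simp add: mult_assoc mult_closed)
  finally have "a \<otimes> (b\<^sup>\<star> \<otimes> x') \<in> Proj S"
    using pinv_sandwich_Proj[OF x Proj_mult[OF e]] by simp
  moreover have "(a\<^sup>\<star> \<otimes> x') \<otimes> b = a\<^sup>\<star> \<otimes> (x' \<otimes> x) \<otimes> b\<^sup>\<star>"
    using arg_cong[OF ab(2), of "\<lambda>z. (a\<^sup>\<star> \<otimes> x') \<otimes> z"] cl by (simp add: mult_assoc mult_closed)
  then have "(a\<^sup>\<star> \<otimes> x') \<otimes> b \<in> Proj S"
    using x e Proj_mult star_Proj cl by (simp add: pinv_def)
  ultimately show ?thesis
    using im_inv_Inv[OF p(1)] im_inv_Inv[OF p(2)]
    by (simp add: compatible_def Idem_Inv Inv_simps)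
qed

lemma im_lub_iff:
  assumes "A \<subseteq> carrier (Inv S)"
  shows "is_lub (im_order (Inv S)) j A \<longleftrightarrow> j \<in> carrier (Inv S) \<and> (\<forall>a\<in>A. leS a j) \<and>
    (\<forall>u\<in>carrier (Inv S). (\<forall>a\<in>A. leS a u) \<longrightarrow> leS j u)"
proof -
  have "Upper (im_order (Inv S)) A = {u \<in> carrier (Inv S). \<forall>a\<in>A. leS a u}"
    using assms im_le by (auto simp: Upper_def im_carrier)
  then show ?thesis using im_le by (auto simp: least_def im_carrier)
qed

lemma lub_im_lub:
  assumes "A \<subseteq> carrier (Inv S)" "lub j A" "j \<in> carrier (Inv S)"
  shows "is_lub (im_order (Inv S)) j A"
proof -
  have "A \<subseteq> carrier S" using assms(1) Inv_carrier by blast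
  then show ?thesis using assms Inv_carrier by (simp add: im_lub_iff lub_iff)
qed

end

context boolean_right_restriction_monoid begin

text \<open>The join \<open>w\<close> in the whole monoid lies below the partial unit \<open>j\<close>, so it is a partial unit
  and competes with \<open>j\<close> inside \<open>Inv(S)\<close>.\<close>

lemma im_lub_lub:
  assumes "finite A" "A \<subseteq> carrier (Inv S)" "is_lub (im_order (Inv S)) j A"
  shows "lub j A"
proof -
  have A: "A \<subseteq> carrier S" using assms(2) Inv_carrier by blast
  have j: "j \<in> carrier (Inv S)" "\<And>a. a \<in> A \<Longrightarrow> leS a j"
    "\<And>u. u \<in> carrier (Inv S) \<Longrightarrow> \<forall>a\<in>A. leS a u \<Longrightarrow> leS j u"
    using assms(2,3) by (simp_all add: im_lub_iff)
  have jc: "j \<in> carrier S" using j(1) Inv_carrier by blast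
  obtain w where w: "lub w A"
    using finite_left_compatible_lub[OF assms(1) A] bounded_left_compatible j(2) jc A by blast
  have wj: "leS w j" using lub_least[OF w A jc j(2)] .
  have wc: "w \<in> carrier S" using lub_closed[OF w] .
  have "leS j w" using j(3) Inv_downward[OF j(1) wj wc] lub_upper[OF w A] by blast
  then have "j = w" using leS_antisym jc wc wj by blast
  then show ?thesis using w by simp
qed

end

section \<open>Homomorphisms of inverse monoids\<close>

lemma (in inverse_monoid) im_inv_eq: "\<lbrakk>a \<in> carrier M; is_inverse M a b\<rbrakk> \<Longrightarrow> im_inv M a = b"
  unfolding im_inv_def using ex1_inverse by blast

lemma (in inverse_monoid) im_inv_is_inverse: "a \<in> carrier M \<Longrightarrow> is_inverse M a (im_inv M a)"
  using ex1_inverse im_inv_eq by blast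

lemma hom_im_inv:
  assumes "inverse_monoid M" "inverse_monoid N" "h \<in> hom M N" "a \<in> carrier M"
  shows "h (im_inv M a) = im_inv N (h a)"
proof -
  interpret M: inverse_monoid M by fact
  interpret N: inverse_monoid N by fact
  let ?b = "im_inv M a"
  have b: "?b \<in> carrier M" "a \<otimes>\<^bsub>M\<^esub> ?b \<otimes>\<^bsub>M\<^esub> a = a" "?b \<otimes>\<^bsub>M\<^esub> a \<otimes>\<^bsub>M\<^esub> ?b = ?b"
    using M.im_inv_is_inverse[OF assms(4)] by (auto simp: is_inverse_def)
  have "is_inverse N (h a) (h ?b)"
    unfolding is_inverse_def
    using b hom_in_carrier[OF assms(3) b(1)] hom_mult[OF assms(3) assms(4) b(1)]
      hom_mult[OF assms(3) b(1) assms(4)] hom_mult[OF assms(3) M.m_closed[OF b(1) assms(4)] b(1)]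
      hom_mult[OF assms(3) M.m_closed[OF assms(4) b(1)] assms(4)] by simp
  then show ?thesis using N.im_inv_eq hom_in_carrier[OF assms(3,4)] by metis
qed

lemma hom_inverse_star:
  assumes "inverse_monoid M" "inverse_monoid N" "h \<in> hom M N" "a \<in> carrier M"
  shows "h (a\<^sup>\<star>\<^bsub>inverse_rr M\<^esub>) = (h a)\<^sup>\<star>\<^bsub>inverse_rr N\<^esub>"
  using inverse_monoid.im_inv_is_inverse[OF assms(1,4)] hom_im_inv[OF assms] assms(3,4)
  by (simp add: inverse_rr_def is_inverse_def hom_mult)

lemma hom_im_order:
  assumes "inverse_monoid M" "inverse_monoid N" "h \<in> hom M N" "a \<in> carrier M" "b \<in> carrier M"
    and "a \<sqsubseteq>\<^bsub>im_order M\<^esub> b"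
  shows "h a \<sqsubseteq>\<^bsub>im_order N\<^esub> h b"
proof -
  let ?s = "a\<^sup>\<star>\<^bsub>inverse_rr M\<^esub>"
  have "?s \<in> carrier M"
    using inverse_monoid.im_inv_is_inverse[OF assms(1,4)] assms(1,4)
    by (simp add: inverse_rr_def is_inverse_def inverse_monoid_def monoid.m_closed)
  moreover have "a = b \<otimes>\<^bsub>M\<^esub> ?s" using assms(6) by (simp add: natural_order_def inverse_rr_def)
  ultimately have "h a = h b \<otimes>\<^bsub>N\<^esub> h ?s" using assms(3,5) hom_mult by metis
  then show ?thesis
    unfolding hom_inverse_star[OF assms(1-4)] by (simp add: natural_order_def inverse_rr_def)
qed

text \<open>Homomorphisms of inverse monoids preserve inverses and hence the natural order. Applied to
  both maps, this makes a bijective homomorphism an order isomorphism, and joins are determined by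
  the order.\<close>

lemma boolean_inverse_iso_inverse:
  assumes "inverse_monoid M" "inverse_monoid N" "h \<in> boolean_inverse_iso M N"
  shows "inv_into (carrier M) h \<in> boolean_inverse_hom N M"
proof -
  interpret M: inverse_monoid M by fact
  interpret N: inverse_monoid N by fact
  let ?g = "inv_into (carrier M) h"
  have h: "h \<in> hom M N" "bij_betw h (carrier M) (carrier N)" "h \<one>\<^bsub>M\<^esub> = \<one>\<^bsub>N\<^esub>"
    using assms(3) by (auto simp: boolean_inverse_iso_def boolean_inverse_hom_def)
  have gh: "?g (h x) = x" if "x \<in> carrier M" for x
    using h(2) that by (simp add: bij_betw_inv_into_left)
  have hg: "h (?g y) = y" if "y \<in> carrier N" for y
    using h(2) that by (simp add: bij_betw_inv_into_right)
  have gc: "?g y \<in> carrier M" if "y \<in> carrier N" for y using h(2) that by (metis bij_betw_apply bij_betw_inv_into)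
  have hc: "h y \<in> carrier N" if "y \<in> carrier M" for y using h(1) that hom_in_carrier by metis
  have "?g (x \<otimes>\<^bsub>N\<^esub> y) = ?g x \<otimes>\<^bsub>M\<^esub> ?g y" if "x \<in> carrier N" "y \<in> carrier N" for x y
    using gh[OF M.m_closed[OF gc[OF that(1)] gc[OF that(2)]]] hom_mult[OF h(1) gc gc] hg that
    by simp
  then have g: "?g \<in> hom N M" using gc by (auto simp: hom_def)
  have one: "?g \<one>\<^bsub>N\<^esub> = \<one>\<^bsub>M\<^esub>" using gh[of "\<one>\<^bsub>M\<^esub>"] h(3) by simp
  have c: "carrier (im_order K) = carrier K" for K :: "('x, 'y) monoid_scheme"
    by (simp add: natural_order_def inverse_rr_def)
  have lub: "is_lub (im_order M) (?g j) (?g ` A)"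
    if A: "A \<subseteq> carrier N" and "is_lub (im_order N) j A" for A j
  proof -
    have j: "j \<in> carrier N" "\<And>a. a \<in> A \<Longrightarrow> a \<sqsubseteq>\<^bsub>im_order N\<^esub> j"
      "\<And>u. u \<in> carrier N \<Longrightarrow> (\<And>a. a \<in> A \<Longrightarrow> a \<sqsubseteq>\<^bsub>im_order N\<^esub> u) \<Longrightarrow> j \<sqsubseteq>\<^bsub>im_order N\<^esub> u"
      using that by (auto simp: least_def Upper_def natural_order_def inverse_rr_def)
    have "?g j \<sqsubseteq>\<^bsub>im_order M\<^esub> u" if u: "u \<in> carrier M" "\<And>a. a \<in> A \<Longrightarrow> ?g a \<sqsubseteq>\<^bsub>im_order M\<^esub> u" for u
    proof -
      have "a \<sqsubseteq>\<^bsub>im_order N\<^esub> h u" if "a \<in> A" for a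
        using hom_im_order[OF assms(1,2) h(1) gc u(1) u(2)] hg A that by auto
      then have "j \<sqsubseteq>\<^bsub>im_order N\<^esub> h u" using j(3) hc u(1) by blast
      then show ?thesis
        using hom_im_order[OF assms(2,1) g j(1) hc[OF u(1)]] gh[OF u(1)] by simp
    qed
    moreover have "?g a \<sqsubseteq>\<^bsub>im_order M\<^esub> ?g j" if "a \<in> A" for a
      using hom_im_order[OF assms(2,1) g _ j(1) j(2)] A that by blast
    moreover have "Upper (im_order M) (?g ` A) = {u \<in> carrier M. \<forall>a\<in>A. ?g a \<sqsubseteq>\<^bsub>im_order M\<^esub> u}"
      using gc A c[of M] by (auto simp: Upper_def)
    ultimately show ?thesis
      using gc[OF j(1)] by (auto simp: least_def c)
  qed
  show ?thesis
    unfolding boolean_inverse_hom_def using g one lub by blast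
qed

section \<open>Extending along joins of partial units\<close>

locale partial_unit_hom =
  S: etale_boolean_right_restriction_monoid S + T: boolean_right_restriction_monoid T
  for S :: "('a, 'c) right_restriction_scheme" and T :: "('b, 'd) right_restriction_scheme" +
  fixes \<theta> :: "'a \<Rightarrow> 'b"
  assumes boolean_hom: "\<theta> \<in> boolean_inverse_hom (Inv S) (Inv T)"
begin

lemma theta_hom: "\<theta> \<in> hom (Inv S) (Inv T)"
  using boolean_hom by (simp add: boolean_inverse_hom_def)

lemma theta_one: "\<theta> \<one>\<^bsub>S\<^esub> = \<one>\<^bsub>T\<^esub>"
  using boolean_hom by (simp add: boolean_inverse_hom_def S.Inv_simps T.Inv_simps)

lemma theta_Inv: "x \<in> carrier (Inv S) \<Longrightarrow> \<theta> x \<in> carrier (Inv T)"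
  using hom_in_carrier[OF theta_hom] .

lemma theta_closed: "x \<in> carrier (Inv S) \<Longrightarrow> \<theta> x \<in> carrier T"
  using theta_Inv T.Inv_carrier by blast

lemma theta_image: "A \<subseteq> carrier (Inv S) \<Longrightarrow> \<theta> ` A \<subseteq> carrier T"
  using theta_closed by blast

lemma theta_mult:
  "\<lbrakk>x \<in> carrier (Inv S); y \<in> carrier (Inv S)\<rbrakk> \<Longrightarrow> \<theta> (x \<otimes>\<^bsub>S\<^esub> y) = \<theta> x \<otimes>\<^bsub>T\<^esub> \<theta> y"
  using hom_mult[OF theta_hom] by (simp add: S.Inv_simps T.Inv_simps)

lemma theta_star:
  assumes "x \<in> carrier (Inv S)"
  shows "\<theta> (x\<^sup>\<star>\<^bsub>S\<^esub>) = (\<theta> x)\<^sup>\<star>\<^bsub>T\<^esub>"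
  using hom_inverse_star[OF S.inverse_monoid_Inv T.inverse_monoid_Inv theta_hom assms]
  by (simp add: S.im_star[OF assms] T.im_star[OF theta_Inv[OF assms]])

text \<open>Left-compatibility of partial units is an equation between products of elements of
  \<open>Inv(S)\<close>.\<close>

lemma theta_left_compatible:
  assumes "x \<in> carrier (Inv S)" "y \<in> carrier (Inv S)" "left_compatible S x y"
  shows "left_compatible T (\<theta> x) (\<theta> y)"
  using arg_cong[OF assms(3)[unfolded left_compatible_def], of \<theta>] assms(1,2)
  by (simp add: left_compatible_def theta_mult theta_star S.Inv_star)

text \<open>The join \<open>x\<close> being a partial unit makes \<open>A\<close> compatible, not merely left-compatible, so that
  the hypothesis on \<open>\<theta>\<close> applies.\<close>

lemma theta_partial_unit_lub:
  assumes "finite A" "A \<subseteq> carrier (Inv S)" "x \<in> carrier (Inv S)" "S.lub x A"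
  shows "T.lub (\<theta> x) (\<theta> ` A)"
proof -
  have A: "A \<subseteq> carrier S" using assms(2) S.Inv_carrier by blast
  have "compatible (Inv S) a b" if "a \<in> A" "b \<in> A" for a b
    using S.bounded_compatible[OF assms(3)] S.lub_upper[OF assms(4) A] A that by blast
  then have "is_lub (im_order (Inv T)) (\<theta> x) (\<theta> ` A)"
    using boolean_hom S.lub_im_lub[OF assms(2,4,3)] assms(1,2)
    unfolding boolean_inverse_hom_def by blast
  then show ?thesis using T.im_lub_lub theta_Inv assms(1,2) by blast
qed

text \<open>Multiplying \<open>a = \<Or>A\<close> by \<open>x\<^sup>\<star>\<close> replaces \<open>A\<close> by a set of partial units whose join is the
  partial unit \<open>x\<close>. This is the reason why different decompositions of \<open>a\<close> lead to the same
  value.\<close>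

lemma theta_le_upper_bound:
  assumes A: "finite A" "A \<subseteq> carrier (Inv S)" "S.lub a A"
    and x: "x \<in> carrier (Inv S)" "S.leS x a"
    and u: "u \<in> carrier T" "\<And>y. y \<in> A \<Longrightarrow> T.leS (\<theta> y) u"
  shows "T.leS (\<theta> x) u"
proof -
  let ?s = "x\<^sup>\<star>\<^bsub>S\<^esub>"
  let ?B = "(\<lambda>y. y \<otimes>\<^bsub>S\<^esub> ?s) ` A"
  have AS: "A \<subseteq> carrier S" using A(2) S.Inv_carrier by blast
  have s: "?s \<in> carrier (Inv S)" using S.Inv_star x(1) .
  have "S.lub (a \<otimes>\<^bsub>S\<^esub> ?s) ?B"
    using S.finite_lub_mult_right[OF A(1) AS A(3)] s S.Inv_carrier by blast
  then have lub: "S.lub x ?B" using x(2) by (simp add: S.leS_def)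
  have B: "?B \<subseteq> carrier (Inv S)" using S.Inv_mult A(2) s by blast
  have "T.leS z u" if "z \<in> \<theta> ` ?B" for z
  proof -
    obtain y where y: "y \<in> A" "y \<in> carrier (Inv S)" "z = \<theta> (y \<otimes>\<^bsub>S\<^esub> ?s)"
      using \<open>z \<in> \<theta> ` ?B\<close> A(2) by auto
    then have z: "z = \<theta> y \<otimes>\<^bsub>T\<^esub> (\<theta> x)\<^sup>\<star>\<^bsub>T\<^esub>" by (simp add: theta_mult theta_star s x(1))
    have "T.leS z (\<theta> y)"
      unfolding z by (rule T.leS_mult_star[OF theta_closed[OF y(2)] theta_closed[OF x(1)]])
    moreover have "z \<in> carrier T"
      unfolding y(3) by (rule theta_closed[OF S.Inv_mult[OF y(2) s]])
    ultimately show ?thesis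
      using T.leS_trans[OF theta_closed[OF y(2)] u(1)] u(2)[OF y(1)] by blast
  qed
  then show ?thesis
    using T.lub_least[OF theta_partial_unit_lub[OF _ B x(1) lub] theta_image[OF B] u(1)] A(1) by blast
qed

text \<open>Taking all partial units below \<open>a\<close> avoids a choice of a decomposition. The set is infinite in
  general, and the existence of its join comes from a finite decomposition, see \<open>ext_lub\<close>.\<close>

definition ext :: "'a \<Rightarrow> 'b"
  where "ext a = (THE y. T.lub y (\<theta> ` {x \<in> carrier (Inv S). S.leS x a}))"

text \<open>The working description of the extension: every finite decomposition of \<open>a\<close> into partial
  units may be used to compute it.\<close>

lemma ext_lub:
  assumes A: "finite A" "A \<subseteq> carrier (Inv S)" "S.lub a A"
  shows "T.lub (ext a) (\<theta> ` A)"
proof -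
  let ?X = "{x \<in> carrier (Inv S). S.leS x a}"
  have AS: "A \<subseteq> carrier S" using A(2) S.Inv_carrier by blast
  have a: "a \<in> carrier S" using S.lub_closed[OF A(3)] .
  have AX: "A \<subseteq> ?X" using A(2) S.lub_upper[OF A(3) AS] by blast
  have "left_compatible T (\<theta> x) (\<theta> y)" if "x \<in> A" "y \<in> A" for x y
  proof -
    have "left_compatible S x y"
      using S.bounded_left_compatible[OF _ _ a] AX AS that by blast
    then show ?thesis using theta_left_compatible A(2) that by blast
  qed
  then obtain y where y: "T.lub y (\<theta> ` A)"
    using T.finite_left_compatible_lub[of "\<theta> ` A"] A(1) theta_image[OF A(2)] by blast
  have yc: "y \<in> carrier T" using T.lub_closed[OF y] .
  have XT: "\<theta> ` ?X \<subseteq> carrier T" by (rule theta_image) blast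
  have up: "T.leS (\<theta> x) y" if "x \<in> ?X" for x
    using theta_le_upper_bound[OF A _ _ yc] T.lub_upper[OF y theta_image[OF A(2)]] that by blast
  have "T.lub y (\<theta> ` ?X)"
    unfolding T.lub_iff[OF XT] using yc up T.lub_least[OF y theta_image[OF A(2)]] AX by blast
  then have "ext a = y"
    unfolding ext_def using T.lub_unique[OF _ _ XT] by blast
  then show ?thesis using y by simp
qed

lemma ext_closed: "a \<in> carrier S \<Longrightarrow> ext a \<in> carrier T"
  using S.etale ext_lub T.lub_closed by blast

lemma ext_extends:
  assumes "x \<in> carrier (Inv S)"
  shows "ext x = \<theta> x"
proof -
  have "T.lub (ext x) {\<theta> x}"
    using ext_lub[of "{x}" x] S.lub_singleton[OF S.Inv_carrier] assms by simp
  then show ?thesis using T.lub_unique T.lub_singleton[of "\<theta> x"] theta_closed[OF assms] by blast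
qed

lemma ext_mult:
  assumes "a \<in> carrier S" "b \<in> carrier S"
  shows "ext (a \<otimes>\<^bsub>S\<^esub> b) = ext a \<otimes>\<^bsub>T\<^esub> ext b"
proof -
  obtain A B where A: "finite A" "A \<subseteq> carrier (Inv S)" "S.lub a A"
    and B: "finite B" "B \<subseteq> carrier (Inv S)" "S.lub b B"
    using S.etale assms by meson
  have AB: "A \<subseteq> carrier S" "B \<subseteq> carrier S" using A(2) B(2) S.Inv_carrier by auto
  let ?P = "\<Union>x\<in>A. (\<lambda>y. x \<otimes>\<^bsub>S\<^esub> y) ` B"
  have "S.lub (a \<otimes>\<^bsub>S\<^esub> b) ?P" using S.finite_lub_mult A B AB by blast
  moreover have P: "?P \<subseteq> carrier (Inv S)" using S.Inv_mult A(2) B(2) by blast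
  ultimately have "T.lub (ext (a \<otimes>\<^bsub>S\<^esub> b)) (\<theta> ` ?P)" using ext_lub A(1) B(1) by simp
  moreover have "\<theta> ` ?P = (\<Union>x\<in>\<theta> ` A. (\<lambda>y. x \<otimes>\<^bsub>T\<^esub> y) ` \<theta> ` B)"
  proof -
    have "\<theta> ` (\<lambda>y. x \<otimes>\<^bsub>S\<^esub> y) ` B = (\<lambda>y. \<theta> x \<otimes>\<^bsub>T\<^esub> y) ` \<theta> ` B" if "x \<in> A" for x
      unfolding image_image using theta_mult A(2) B(2) that by (intro image_cong) auto
    then show ?thesis by (simp add: image_UN)
  qed
  moreover have "T.lub (ext a \<otimes>\<^bsub>T\<^esub> ext b) (\<Union>x\<in>\<theta> ` A. (\<lambda>y. x \<otimes>\<^bsub>T\<^esub> y) ` \<theta> ` B)"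
    using T.finite_lub_mult[OF _ theta_image[OF A(2)] ext_lub[OF A] _ theta_image[OF B(2)] ext_lub[OF B]]
      A(1) B(1) by blast
  ultimately show ?thesis using T.lub_unique theta_image[OF P] by metis
qed

lemma ext_star:
  assumes "a \<in> carrier S"
  shows "ext (a\<^sup>\<star>\<^bsub>S\<^esub>) = (ext a)\<^sup>\<star>\<^bsub>T\<^esub>"
proof -
  obtain A where A: "finite A" "A \<subseteq> carrier (Inv S)" "S.lub a A" using S.etale assms by meson
  have AS: "A \<subseteq> carrier S" using A(2) S.Inv_carrier by auto
  have st: "rstar S ` A \<subseteq> carrier (Inv S)" using S.Inv_star A(2) by blast
  have "T.lub (ext (a\<^sup>\<star>\<^bsub>S\<^esub>)) (\<theta> ` rstar S ` A)"
    using ext_lub[OF _ st S.finite_lub_star[OF A(1) AS A(3)]] A(1) by blast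
  moreover have "\<theta> ` rstar S ` A = rstar T ` \<theta> ` A"
    unfolding image_image using theta_star A(2) by (intro image_cong) auto
  moreover have "T.lub ((ext a)\<^sup>\<star>\<^bsub>T\<^esub>) (rstar T ` \<theta> ` A)"
    using T.finite_lub_star[OF _ theta_image[OF A(2)] ext_lub[OF A]] A(1) by blast
  ultimately show ?thesis using T.lub_unique theta_image[OF st] by metis
qed

text \<open>Decompose each member of \<open>F\<close>; the union of the decompositions is a decomposition of \<open>j\<close>, and
  regrouping its image gives the claim.\<close>

lemma ext_join:
  assumes "finite F" "F \<subseteq> carrier S" "S.lub j F"
  shows "T.lub (ext j) (ext ` F)"
proof -
  have "\<forall>a\<in>F. \<exists>A. finite A \<and> A \<subseteq> carrier (Inv S) \<and> S.lub a A" using S.etale assms(2) by blast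
  then obtain G where G: "\<And>a. a \<in> F \<Longrightarrow> finite (G a)" "\<And>a. a \<in> F \<Longrightarrow> G a \<subseteq> carrier (Inv S)"
    "\<And>a. a \<in> F \<Longrightarrow> S.lub a (G a)" by metis
  have GS: "G a \<subseteq> carrier S" if "a \<in> F" for a using G(2)[OF that] S.Inv_carrier by blast
  have "S.lub j (\<Union>a\<in>F. G a)" using S.lub_UN[of F G "\<lambda>a. a"] GS G(3) assms(3) by simp
  then have "T.lub (ext j) (\<theta> ` (\<Union>a\<in>F. G a))" using ext_lub assms(1) G(1,2) by blast
  then have "T.lub (ext j) (\<Union>a\<in>F. \<theta> ` G a)" by (simp add: image_UN)
  then show ?thesis using T.lub_UN[of F "\<lambda>a. \<theta> ` G a" ext] theta_image[OF G(2)] ext_lub[OF G] by blast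
qed

lemma ext_boolean_rr_hom: "ext \<in> boolean_rr_hom S T"
proof -
  have "ext \<one>\<^bsub>S\<^esub> = \<one>\<^bsub>T\<^esub>" using ext_extends S.Proj_Inv[OF S.one_Proj] theta_one by simp
  then show ?thesis
    unfolding boolean_rr_hom_def rr_monoid_hom_def rr_hom_def hom_def
    using ext_closed ext_mult ext_star ext_join by blast
qed

lemma ext_unique:
  assumes "\<psi> \<in> boolean_rr_hom S T" "\<And>x. x \<in> carrier (Inv S) \<Longrightarrow> \<psi> x = \<theta> x" "a \<in> carrier S"
  shows "\<psi> a = ext a"
proof -
  obtain A where A: "finite A" "A \<subseteq> carrier (Inv S)" "S.lub a A" using S.etale assms(3) by meson
  have AS: "A \<subseteq> carrier S" using A(2) S.Inv_carrier by auto
  have "left_compatible S x y" if "x \<in> A" "y \<in> A" for x y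
    using S.bounded_left_compatible[OF _ _ assms(3)] S.lub_upper[OF A(3) AS] AS that by blast
  then have "T.lub (\<psi> a) (\<psi> ` A)"
    using assms(1) A AS unfolding boolean_rr_hom_def by blast
  moreover have "\<psi> ` A = \<theta> ` A" using assms(2) A(2) by (intro image_cong) auto
  ultimately show ?thesis using T.lub_unique[OF _ ext_lub[OF A] theta_image[OF A(2)]] by simp
qed

end

lemma partial_unit_homI:
  assumes "etale_boolean_right_restriction_monoid S" "etale_boolean_right_restriction_monoid T"
    and "\<theta> \<in> boolean_inverse_hom (Inv S) (Inv T)"
  shows "partial_unit_hom S T \<theta>"
  using assms unfolding partial_unit_hom_def partial_unit_hom_axioms_def
    etale_boolean_right_restriction_monoid_def by simp

text \<open>A decomposition of \<open>a\<close> is mapped to one of its image and then back to itself.\<close>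

lemma ext_left_inverse:
  assumes "partial_unit_hom S T \<theta>" "partial_unit_hom T S \<eta>"
    and "\<And>x. x \<in> carrier (Inv S) \<Longrightarrow> \<eta> (\<theta> x) = x" and a: "a \<in> carrier S"
  shows "partial_unit_hom.ext T S \<eta> (partial_unit_hom.ext S T \<theta> a) = a"
proof -
  interpret F: partial_unit_hom S T \<theta> by fact
  interpret G: partial_unit_hom T S \<eta> by fact
  obtain A where A: "finite A" "A \<subseteq> carrier (Inv S)" "F.S.lub a A" using F.S.etale a by meson
  have "\<theta> ` A \<subseteq> carrier (Inv T)" using F.theta_Inv A(2) by blast
  then have "F.S.lub (G.ext (F.ext a)) (\<eta> ` \<theta> ` A)" using G.ext_lub F.ext_lub[OF A] A(1) by blast
  moreover have "\<eta> ` \<theta> ` A = A"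
    unfolding image_image using assms(3) A(2) by (subst image_cong[OF refl, of A _ "\<lambda>x. x"]) auto
  moreover have "A \<subseteq> carrier S" using A(2) F.S.Inv_carrier by blast
  ultimately show ?thesis using F.S.lub_unique A(3) by metis
qed

lemma ext_bij_betw:
  assumes "partial_unit_hom S T \<theta>" "partial_unit_hom T S \<eta>"
    and "\<And>x. x \<in> carrier (Inv S) \<Longrightarrow> \<eta> (\<theta> x) = x"
    and "\<And>y. y \<in> carrier (Inv T) \<Longrightarrow> \<theta> (\<eta> y) = y"
  shows "bij_betw (partial_unit_hom.ext S T \<theta>) (carrier S) (carrier T)"
  using ext_left_inverse[OF assms(1,2,3)] ext_left_inverse[OF assms(2,1,4)]
    partial_unit_hom.ext_closed[OF assms(1)] partial_unit_hom.ext_closed[OF assms(2)]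
  by (intro bij_betwI[where g = "partial_unit_hom.ext T S \<eta>"]) auto

theorem theorem5p2:
  fixes S :: "('a, 'c) right_restriction_scheme"
    and T :: "('b, 'd) right_restriction_scheme"
  assumes "etale_boolean_right_restriction_monoid S"
    and "etale_boolean_right_restriction_monoid T"
  shows "(\<forall>\<theta> \<in> boolean_inverse_hom (Inv S) (Inv T).
            \<exists>\<phi> \<in> boolean_rr_hom S T. (\<forall>a \<in> carrier (Inv S). \<phi> a = \<theta> a) \<and>
              (\<forall>\<psi> \<in> boolean_rr_hom S T. (\<forall>a \<in> carrier (Inv S). \<psi> a = \<theta> a)
                 \<longrightarrow> (\<forall>a \<in> carrier S. \<psi> a = \<phi> a)))
       \<and> (boolean_inverse_iso (Inv S) (Inv T) \<noteq> {} \<longrightarrow> rr_iso S T \<noteq> {})"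
proof (intro conjI ballI impI)
  fix \<theta> assume "\<theta> \<in> boolean_inverse_hom (Inv S) (Inv T)"
  then interpret F: partial_unit_hom S T \<theta> by (rule partial_unit_homI[OF assms])
  show "\<exists>\<phi> \<in> boolean_rr_hom S T. (\<forall>a \<in> carrier (Inv S). \<phi> a = \<theta> a) \<and>
      (\<forall>\<psi> \<in> boolean_rr_hom S T. (\<forall>a \<in> carrier (Inv S). \<psi> a = \<theta> a)
         \<longrightarrow> (\<forall>a \<in> carrier S. \<psi> a = \<phi> a))"
    using F.ext_boolean_rr_hom F.ext_extends F.ext_unique by (intro bexI[of _ F.ext]) auto
next
  interpret S: etale_boolean_right_restriction_monoid S by fact
  interpret T: etale_boolean_right_restriction_monoid T by fact
  assume "boolean_inverse_iso (Inv S) (Inv T) \<noteq> {}"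
  then obtain \<theta> where iso: "\<theta> \<in> boolean_inverse_iso (Inv S) (Inv T)" by blast
  then have bij: "bij_betw \<theta> (carrier (Inv S)) (carrier (Inv T))"
    and ST: "partial_unit_hom S T \<theta>"
    using partial_unit_homI[OF assms] by (simp_all add: boolean_inverse_iso_def)
  have TS: "partial_unit_hom T S (inv_into (carrier (Inv S)) \<theta>)"
    using partial_unit_homI[OF assms(2,1)]
      boolean_inverse_iso_inverse[OF S.inverse_monoid_Inv T.inverse_monoid_Inv iso] by blast
  have "bij_betw (partial_unit_hom.ext S T \<theta>) (carrier S) (carrier T)"
    using ext_bij_betw[OF ST TS] bij
    by (simp add: bij_betw_inv_into_left bij_betw_inv_into_right)
  then show "rr_iso S T \<noteq> {}"
    using partial_unit_hom.ext_boolean_rr_hom[OF ST]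
    by (auto simp: rr_iso_def boolean_rr_hom_def rr_monoid_hom_def)
qed

end
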